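(* Let $(M^n,g)$ be a compact non-balanced Bismut torsion-parallel (BTP) Hermitian manifold of complex dimension $n$, and let $(\alpha,\beta)\in\mathbb R^2$ with $(\alpha,\beta)\neq(0,0)$. If the mixed curvature satisfies $\mathcal C_{\alpha,\beta}=c$ for some constant $c\in\mathbb R$, then $c=0$.
   Context: For a Hermitian manifold $(M^n,g)$ of complex dimension $n$ with Kähler form $\omega$: $g$ is balanced if $d(\omega^{n-1})=0$, and non-balanced otherwise. The Bismut connection $\nabla^b$ is the unique connection with $\nabla^b g=0$, $\nabla^b J=0$ and totally skew-symmetric torsion $T^b$; $g$ is Bismut torsion-parallel (BTP) if $\nabla^bT^b=0$. Let $R$ be the curvature tensor of the Chern connection. For a nonzero $(1,0)$ tangent vector $X$, $H(X)=R(X,\overline X,X,\overline X)/|X|^4$ is the holomorphic sectional curvature, and $\operatorname{Ric}(X,\overline X)=\sum_{i=1}^n R(X,\overline X,e_i,\overline e_i)$ is the first Chern Ricci curvature, where $\{e_i\}$ is any local unitary frame of $(1,0)$ vectors (the last two arguments are the bundle, i.e. endomorphism, indices of the curvature). For real $\alpha,\beta$ the mixed curvature is $\mathcal C_{\alpha,\beta}(X)=\alpha\operatorname{Ric}(X,\overline X)+\beta H(X)$ for unit $(1,0)$ tangent vectors $X$. "$\mathcal C_{\alpha,\beta}=c$" means $\mathcal C_{\alpha,\beta}(X)=c$ for every unit $(1,0)$ tangent vector $X$ at every point. *)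

theory Defs
  imports "HOL-Analysis.Analysis"
begin

section \<open>Smooth and holomorphic maps\<close>

fun Ck_on :: "nat \<Rightarrow> ('a::real_normed_vector \<Rightarrow> 'b::real_normed_vector) \<Rightarrow> 'a set \<Rightarrow> bool" where
  "Ck_on 0 f S \<longleftrightarrow> continuous_on S f"
| "Ck_on (Suc k) f S \<longleftrightarrow>
     (\<forall>x\<in>S. f differentiable (at x)) \<and> (\<forall>v. Ck_on k (\<lambda>x. frechet_derivative f (at x) v) S)"

text \<open>Only used for open \<^term>\<open>S\<close>.\<close>

definition smooth_on :: "('a::real_normed_vector \<Rightarrow> 'b::real_normed_vector) \<Rightarrow> 'a set \<Rightarrow> bool" where
  "smooth_on f S \<longleftrightarrow> (\<forall>k. Ck_on k f S)"

text \<open>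
  The space \<^typ>\<open>complex^'n\<close> is used as a real vector space of dimension $2n$; in a holomorphic
  chart the complex structure of the tangent space is multiplication by $i$.
\<close>

abbreviation J :: "complex^'n \<Rightarrow> complex^'n" where
  "J v \<equiv> \<i> *s v"

definition holomorphic_map_on :: "(complex^'n::finite \<Rightarrow> complex^'n) \<Rightarrow> (complex^'n) set \<Rightarrow> bool" where
  "holomorphic_map_on f S \<longleftrightarrow>
     (\<forall>x\<in>S. f differentiable (at x) \<and>
        (\<forall>v. frechet_derivative f (at x) (J v) = J (frechet_derivative f (at x) v)))"


section \<open>Complex manifolds\<close>

text \<open>A chart is a pair of its domain and its coordinate map.\<close>

type_synonym ('m, 'n) chart = "'m set \<times> ('m \<Rightarrow> complex^'n)"

definition chart_image :: "('m, 'n::finite) chart \<Rightarrow> (complex^'n) set" where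
  "chart_image c = snd c ` fst c"

definition overlap :: "('m, 'n::finite) chart \<Rightarrow> ('m, 'n) chart \<Rightarrow> (complex^'n) set" where
  "overlap c d = snd c ` (fst c \<inter> fst d)"

definition transition :: "('m, 'n::finite) chart \<Rightarrow> ('m, 'n) chart \<Rightarrow> complex^'n \<Rightarrow> complex^'n" where
  "transition c d x = snd d (the_inv_into (fst c) (snd c) x)"

abbreviation dtransition ::
  "('m, 'n::finite) chart \<Rightarrow> ('m, 'n) chart \<Rightarrow> complex^'n \<Rightarrow> complex^'n \<Rightarrow> complex^'n" where
  "dtransition c d x \<equiv> frechet_derivative (transition c d) (at x)"

definition complex_manifold :: "'m topology \<Rightarrow> ('m, 'n::finite) chart set \<Rightarrow> bool" where
  "complex_manifold M A \<longleftrightarrow>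
     Hausdorff_space M \<and> second_countable M \<and> (\<Union>c\<in>A. fst c) = topspace M \<and>
     (\<forall>c\<in>A. openin M (fst c) \<and> open (chart_image c) \<and>
        homeomorphic_map (subtopology M (fst c)) (top_of_set (chart_image c)) (snd c)) \<and>
     (\<forall>c\<in>A. \<forall>d\<in>A. holomorphic_map_on (transition c d) (overlap c d))"


section \<open>Hermitian metrics\<close>

text \<open>
  Tensor fields are given by their coordinate expressions in the charts of the atlas, subject to
  the transformation law. The value \<open>g c x u v\<close> is the Riemannian inner product of the real
  tangent vectors with coordinates \<open>u\<close>, \<open>v\<close> at the point with coordinates \<open>x\<close> in the chart \<open>c\<close>.
\<close>

type_synonym ('m, 'n) metric =
  "('m, 'n) chart \<Rightarrow> complex^'n \<Rightarrow> complex^'n \<Rightarrow> complex^'n \<Rightarrow> real"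

definition hermitian_metric :: "('m, 'n::finite) chart set \<Rightarrow> ('m, 'n) metric \<Rightarrow> bool" where
  "hermitian_metric A g \<longleftrightarrow>
     (\<forall>c\<in>A.
        (\<forall>u v. smooth_on (\<lambda>x. g c x u v) (chart_image c)) \<and>
        (\<forall>x\<in>chart_image c.
           bilinear (g c x) \<and>
           (\<forall>u v. g c x u v = g c x v u) \<and>
           (\<forall>u. u \<noteq> 0 \<longrightarrow> g c x u u > 0) \<and>
           (\<forall>u v. g c x (J u) (J v) = g c x u v))) \<and>
     (\<forall>c\<in>A. \<forall>d\<in>A. \<forall>x\<in>overlap c d. \<forall>u v.
        g c x u v = g d (transition c d x) (dtransition c d x u) (dtransition c d x v))"

text \<open>
  A real tangent vector \<open>v\<close> is identified with its $(1,0)$-part $v^{1,0} = (v - iJv)/2$; in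
  coordinates, \<open>v\<close> is then the vector of coefficients of $v^{1,0}$ with respect to
  $\partial/\partial z_i$. With the complex bilinear extension of \<open>g\<close>, the following is
  $g(v^{1,0}, \overline{w^{1,0}})$.
\<close>

definition herm :: "('m, 'n::finite) metric \<Rightarrow> ('m, 'n) chart \<Rightarrow> complex^'n \<Rightarrow>
    complex^'n \<Rightarrow> complex^'n \<Rightarrow> complex" where
  "herm g c x v w = (complex_of_real (g c x v w) + \<i> * complex_of_real (g c x v (J w))) / 2"

definition unitary_frame :: "('m, 'n::finite) metric \<Rightarrow> ('m, 'n) chart \<Rightarrow> complex^'n \<Rightarrow>
    ('n \<Rightarrow> complex^'n) \<Rightarrow> bool" where
  "unitary_frame g c x e \<longleftrightarrow> (\<forall>i j. herm g c x (e i) (e j) = (if i = j then 1 else 0))"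


section \<open>Differential forms and balanced metrics\<close>

text \<open>
  A \<open>k\<close>-form on a vector space is represented as a function of a sequence of vectors that
  depends on the entries \<open>0, \<dots>, k - 1\<close> only.
\<close>

type_synonym 'a form = "(nat \<Rightarrow> 'a) \<Rightarrow> real"

definition wedge :: "nat \<Rightarrow> nat \<Rightarrow> 'a form \<Rightarrow> 'a form \<Rightarrow> 'a form" where
  "wedge k l a b v =
     (\<Sum>p | p permutes {..<k + l}.
        of_int (sign p) * a (\<lambda>i. v (p i)) * b (\<lambda>i. v (p (k + i)))) / (fact k * fact l)"

fun wedge_power :: "nat \<Rightarrow> 'a form \<Rightarrow> nat \<Rightarrow> 'a form" where
  "wedge_power k a 0 = (\<lambda>v. 1)"
| "wedge_power k a (Suc m) = wedge k (k * m) a (wedge_power k a m)"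

definition ext_deriv :: "nat \<Rightarrow> ('a::real_normed_vector \<Rightarrow> 'a form) \<Rightarrow> 'a \<Rightarrow> 'a form" where
  "ext_deriv k w x v =
     (\<Sum>i\<le>k. (-1) ^ i *
        frechet_derivative (\<lambda>y. w y (\<lambda>j. if j < i then v j else v (Suc j))) (at x) (v i))"

definition kaehler_form :: "('m, 'n::finite) metric \<Rightarrow> ('m, 'n) chart \<Rightarrow> complex^'n \<Rightarrow>
    (complex^'n) form" where
  "kaehler_form g c x v = g c x (J (v 0)) (v 1)"

definition balanced :: "('m, 'n::finite) chart set \<Rightarrow> ('m, 'n) metric \<Rightarrow> bool" where
  "balanced A g \<longleftrightarrow>
     (\<forall>c\<in>A. \<forall>x\<in>chart_image c. \<forall>v.
        ext_deriv (2 * (CARD('n) - 1))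
          (\<lambda>y. wedge_power 2 (kaehler_form g c y) (CARD('n) - 1)) x v = 0)"


section \<open>Connections\<close>

text \<open>
  A linear connection on the (real) tangent bundle is given by its Christoffel symbols: for a
  vector field \<open>Y\<close>, $\nabla_u Y = D_u Y + \Gamma(u, Y)$ in the chart \<open>c\<close>.
\<close>

type_synonym ('m, 'n) christoffel =
  "('m, 'n) chart \<Rightarrow> complex^'n \<Rightarrow> complex^'n \<Rightarrow> complex^'n \<Rightarrow> complex^'n"

definition linear_connection :: "('m, 'n::finite) chart set \<Rightarrow> ('m, 'n) christoffel \<Rightarrow> bool" where
  "linear_connection A \<Gamma> \<longleftrightarrow>
     (\<forall>c\<in>A.
        (\<forall>u v. smooth_on (\<lambda>x. \<Gamma> c x u v) (chart_image c)) \<and>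
        (\<forall>x\<in>chart_image c. bilinear (\<Gamma> c x))) \<and>
     (\<forall>c\<in>A. \<forall>d\<in>A. \<forall>x\<in>overlap c d. \<forall>u v.
        \<Gamma> d (transition c d x) (dtransition c d x u) (dtransition c d x v) =
        dtransition c d x (\<Gamma> c x u v) -
        frechet_derivative (\<lambda>y. dtransition c d y v) (at x) u)"

text \<open>$\nabla g = 0$\<close>

definition metric_parallel ::
  "('m, 'n::finite) chart set \<Rightarrow> ('m, 'n) metric \<Rightarrow> ('m, 'n) christoffel \<Rightarrow> bool" where
  "metric_parallel A g \<Gamma> \<longleftrightarrow>
     (\<forall>c\<in>A. \<forall>x\<in>chart_image c. \<forall>u v w.
        frechet_derivative (\<lambda>y. g c y v w) (at x) u -
        g c x (\<Gamma> c x u v) w - g c x v (\<Gamma> c x u w) = 0)"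

text \<open>$\nabla J = 0$; there is no derivative term since $J$ is constant in holomorphic charts.\<close>

definition complex_structure_parallel ::
  "('m, 'n::finite) chart set \<Rightarrow> ('m, 'n) christoffel \<Rightarrow> bool" where
  "complex_structure_parallel A \<Gamma> \<longleftrightarrow>
     (\<forall>c\<in>A. \<forall>x\<in>chart_image c. \<forall>u v. \<Gamma> c x u (J v) - J (\<Gamma> c x u v) = 0)"

text \<open>The bracket term vanishes on coordinate (constant) vector fields.\<close>

definition torsion :: "('m, 'n::finite) christoffel \<Rightarrow> ('m, 'n) christoffel" where
  "torsion \<Gamma> c x u v = \<Gamma> c x u v - \<Gamma> c x v u"

definition skew_torsion ::
  "('m, 'n::finite) chart set \<Rightarrow> ('m, 'n) metric \<Rightarrow> ('m, 'n) christoffel \<Rightarrow> bool" where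
  "skew_torsion A g \<Gamma> \<longleftrightarrow>
     (\<forall>c\<in>A. \<forall>x\<in>chart_image c. \<forall>u v w.
        g c x (torsion \<Gamma> c x u v) w = - g c x (torsion \<Gamma> c x v u) w \<and>
        g c x (torsion \<Gamma> c x u v) w = - g c x (torsion \<Gamma> c x u w) v)"

text \<open>$\nabla T = 0$\<close>

definition torsion_parallel :: "('m, 'n::finite) chart set \<Rightarrow> ('m, 'n) christoffel \<Rightarrow> bool" where
  "torsion_parallel A \<Gamma> \<longleftrightarrow>
     (\<forall>c\<in>A. \<forall>x\<in>chart_image c. \<forall>u v w.
        frechet_derivative (\<lambda>y. torsion \<Gamma> c y v w) (at x) u + \<Gamma> c x u (torsion \<Gamma> c x v w) -
        torsion \<Gamma> c x (\<Gamma> c x u v) w - torsion \<Gamma> c x v (\<Gamma> c x u w) = 0)"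

definition bismut_connection ::
  "('m, 'n::finite) chart set \<Rightarrow> ('m, 'n) metric \<Rightarrow> ('m, 'n) christoffel \<Rightarrow> bool" where
  "bismut_connection A g \<Gamma> \<longleftrightarrow>
     linear_connection A \<Gamma> \<and> metric_parallel A g \<Gamma> \<and> complex_structure_parallel A \<Gamma> \<and>
     skew_torsion A g \<Gamma>"

definition bismut_torsion_parallel :: "('m, 'n::finite) chart set \<Rightarrow> ('m, 'n) metric \<Rightarrow> bool" where
  "bismut_torsion_parallel A g \<longleftrightarrow> (\<exists>\<Gamma>. bismut_connection A g \<Gamma> \<and> torsion_parallel A \<Gamma>)"

text \<open>
  The Chern connection is the metric connection with $\nabla J = 0$ and
  $\nabla^{0,1} = \overline\partial$. The latter says that $\partial/\partial z_i$ is annihilated by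
  $\nabla_{\overline X}$ for $X$ of type $(1,0)$, i.e. that $\Gamma$ is complex linear in the
  direction of differentiation.
\<close>

definition chern_connection ::
  "('m, 'n::finite) chart set \<Rightarrow> ('m, 'n) metric \<Rightarrow> ('m, 'n) christoffel \<Rightarrow> bool" where
  "chern_connection A g \<Gamma> \<longleftrightarrow>
     linear_connection A \<Gamma> \<and> metric_parallel A g \<Gamma> \<and> complex_structure_parallel A \<Gamma> \<and>
     (\<forall>c\<in>A. \<forall>x\<in>chart_image c. \<forall>u v. \<Gamma> c x (J u) v = J (\<Gamma> c x u v))"


text \<open>Uniqueness of the Bismut and Chern connections\<close>

lemma bismut_connection_unique:
  assumes g: "hermitian_metric A g"
    and b1: "bismut_connection A g \<Gamma>" and b2: "bismut_connection A g \<Delta>"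
    and c: "c \<in> A" and x: "x \<in> chart_image c"
  shows "\<Gamma> c x u v = \<Delta> c x u v"
proof -
  define a where "a u v w = g c x (\<Gamma> c x u v) w - g c x (\<Delta> c x u v) w" for u v w
  have bil: "bilinear (g c x)" and sym: "g c x p q = g c x q p"
    and pos: "p \<noteq> 0 \<Longrightarrow> g c x p p > 0" and herm: "g c x (J p) (J q) = g c x p q" for p q
    using g c x unfolding hermitian_metric_def by blast+
  have skew: "a p q r = - a p r q" for p q r
  proof -
    have "g c x (\<Gamma> c x p q) r + g c x q (\<Gamma> c x p r) = g c x (\<Delta> c x p q) r + g c x q (\<Delta> c x p r)"
      using b1 b2 c x unfolding bismut_connection_def metric_parallel_def
      by (simp add: algebra_simps)
    then show ?thesis
      unfolding a_def
      using sym[of q "\<Gamma> c x p r"] sym[of q "\<Delta> c x p r"] by linarith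
  qed
  have tor: "a p q r - a q p r = - (a p r q - a r p q)" for p q r
  proof -
    have "g c x (torsion \<Gamma> c x p q) r = - g c x (torsion \<Gamma> c x p r) q"
      "g c x (torsion \<Delta> c x p q) r = - g c x (torsion \<Delta> c x p r) q"
      using b1 b2 c x unfolding bismut_connection_def skew_torsion_def by blast+
    then show ?thesis
      unfolding a_def torsion_def by (simp add: bilinear_lsub[OF bil])
  qed
  have skew13: "a p q r = - a r q p" for p q r
    using tor[of p r q] skew[of p r q] skew[of r p q] skew[of q p r] skew[of q r p]
      tor[of p q r] tor[of q p r] skew[of r q p] skew[of p q r]
    by linarith
  have J2: "a p (J q) (J r) = a p q r" for p q r
  proof -
    have "\<Gamma> c x p (J q) = J (\<Gamma> c x p q)" "\<Delta> c x p (J q) = J (\<Delta> c x p q)"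
      using b1 b2 c x unfolding bismut_connection_def complex_structure_parallel_def by auto
    then show ?thesis unfolding a_def by (simp add: herm)
  qed
  have JJ: "J (J p) = - p" for p :: "complex^'n"
    by (simp add: vec_eq_iff vector_scalar_mult_def)
  have neg: "a p (- q) r = - a p q r" for p q r
  proof -
    have "a p (- q) r = - a p r (- q)" by (rule skew)
    also have "a p r (- q) = - a p r q" by (simp add: a_def bilinear_rneg[OF bil])
    finally show ?thesis using skew[of p q r] by linarith
  qed
  have move: "a p q (J r) = - a p (J q) r" for p q r
    using J2[of p "J q" r] by (simp add: JJ neg)
  have "a p q r = 0" for p q r
  proof -
    have 1: "a p (J q) r = - a p q (J r)" for p q r using move[of p q r] by simp
    have 2: "a (J p) q r = - a p (J q) r" for p q r
      using skew13[of "J p" q r] move[of r q p] skew13[of r "J q" p] by linarith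
    have 3: "a (J p) q r = - a p q (J r)" for p q r
      using 2[of p r q] skew[of "J p" q r] skew[of p "J r" q] by linarith
    have "a p q (J r) = 0" for p q r
      using 1[of p q r] 2[of p q r] 3[of p q r] by linarith
    from this[of p q "J r"] show ?thesis
      by (simp add: JJ a_def bilinear_rneg[OF bil])
  qed
  then have "g c x (\<Gamma> c x u v - \<Delta> c x u v) (\<Gamma> c x u v - \<Delta> c x u v) = 0"
    by (simp add: a_def bilinear_lsub[OF bil])
  then show ?thesis
    using pos[of "\<Gamma> c x u v - \<Delta> c x u v"] by force
qed

lemma chern_connection_unique:
  assumes g: "hermitian_metric A g"
    and b1: "chern_connection A g \<Gamma>" and b2: "chern_connection A g \<Delta>"
    and c: "c \<in> A" and x: "x \<in> chart_image c"
  shows "\<Gamma> c x u v = \<Delta> c x u v"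
proof -
  define a where "a u v w = g c x (\<Gamma> c x u v) w - g c x (\<Delta> c x u v) w" for u v w
  have bil: "bilinear (g c x)" and sym: "g c x p q = g c x q p"
    and pos: "p \<noteq> 0 \<Longrightarrow> g c x p p > 0" and herm: "g c x (J p) (J q) = g c x p q" for p q
    using g c x unfolding hermitian_metric_def by blast+
  have skew: "a p q r = - a p r q" for p q r
  proof -
    have "g c x (\<Gamma> c x p q) r + g c x q (\<Gamma> c x p r) = g c x (\<Delta> c x p q) r + g c x q (\<Delta> c x p r)"
      using b1 b2 c x unfolding chern_connection_def metric_parallel_def
      by (simp add: algebra_simps)
    then show ?thesis
      unfolding a_def
      using sym[of q "\<Gamma> c x p r"] sym[of q "\<Delta> c x p r"] by linarith
  qed
  have J12: "\<Gamma> c x p (J q) = J (\<Gamma> c x p q)" "\<Delta> c x p (J q) = J (\<Delta> c x p q)"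
      "\<Gamma> c x (J p) q = J (\<Gamma> c x p q)" "\<Delta> c x (J p) q = J (\<Delta> c x p q)" for p q
      using b1 b2 c x unfolding chern_connection_def complex_structure_parallel_def by auto
  have J2: "a p (J q) (J r) = a p q r" and J1: "a (J p) q r = a p (J q) r" for p q r
    unfolding a_def by (simp_all add: herm J12)
  have JJ: "J (J p) = - p" for p :: "complex^'n"
    by (simp add: vec_eq_iff vector_scalar_mult_def)
  have neg: "a p q (- r) = - a p q r" for p q r
    by (simp add: a_def bilinear_rneg[OF bil])
  have "a p q r = 0" for p q r
  proof -
    have 1: "a (J p) q r = - a p q (J r)" for p q r
      using J1[of p q r] J2[of p q "J r"] by (simp add: JJ neg)
    have 2: "a (J p) q r = a p q (J r)" for p q r
      using J1[of p r q] skew[of "J p" q r] skew[of p q "J r"] by simp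
    have "a p q (J r) = 0" for p q r using 1[of p q r] 2[of p q r] by simp
    from this[of p q "J r"] show ?thesis by (simp add: JJ neg)
  qed
  then have "g c x (\<Gamma> c x u v - \<Delta> c x u v) (\<Gamma> c x u v - \<Delta> c x u v) = 0"
    by (simp add: a_def bilinear_lsub[OF bil])
  then show ?thesis
    using pos[of "\<Gamma> c x u v - \<Delta> c x u v"] by force
qed


section \<open>Curvature\<close>

text \<open>$R(u, v) w = \nabla_u \nabla_v w - \nabla_v \nabla_u w$ for constant \<open>u\<close>, \<open>v\<close>, \<open>w\<close>\<close>

definition curvature :: "('m, 'n::finite) christoffel \<Rightarrow> ('m, 'n) chart \<Rightarrow> complex^'n \<Rightarrow>
    complex^'n \<Rightarrow> complex^'n \<Rightarrow> complex^'n \<Rightarrow> complex^'n" where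
  "curvature \<Gamma> c x u v w =
     frechet_derivative (\<lambda>y. \<Gamma> c y v w) (at x) u - frechet_derivative (\<lambda>y. \<Gamma> c y u w) (at x) v +
     \<Gamma> c x u (\<Gamma> c x v w) - \<Gamma> c x v (\<Gamma> c x u w)"

text \<open>
  For $(1,0)$-vectors $X, Y, Z, W$, given by their coefficients, this is
  $R(X, \overline Y, Z, \overline W) = g(R(X, \overline Y) Z, \overline W)$. It is obtained by
  inserting $X = (X - iJX)/2$ and $\overline Y = (Y + iJY)/2$ into the complex bilinear extension
  of the curvature in its first two arguments; \<open>\<Gamma>\<close> is meant to satisfy $\nabla J = 0$, so that
  $R(u, v)$ preserves the type of $Z$.
\<close>

definition curv4 :: "('m, 'n::finite) metric \<Rightarrow> ('m, 'n) christoffel \<Rightarrow> ('m, 'n) chart \<Rightarrow> complex^'n \<Rightarrow>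
    complex^'n \<Rightarrow> complex^'n \<Rightarrow> complex^'n \<Rightarrow> complex^'n \<Rightarrow> complex" where
  "curv4 g \<Gamma> c x X Y Z W =
     (herm g c x (curvature \<Gamma> c x X Y Z) W
      + \<i> * herm g c x (curvature \<Gamma> c x X (J Y) Z) W
      - \<i> * herm g c x (curvature \<Gamma> c x (J X) Y Z) W
      + herm g c x (curvature \<Gamma> c x (J X) (J Y) Z) W) / 4"

definition hol_sect_curv :: "('m, 'n::finite) metric \<Rightarrow> ('m, 'n) christoffel \<Rightarrow> ('m, 'n) chart \<Rightarrow>
    complex^'n \<Rightarrow> complex^'n \<Rightarrow> complex" where
  "hol_sect_curv g \<Gamma> c x X = curv4 g \<Gamma> c x X X X X / (herm g c x X X)\<^sup>2"

text \<open>The sum does not depend on the unitary frame.\<close>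

definition first_ricci :: "('m, 'n::finite) metric \<Rightarrow> ('m, 'n) christoffel \<Rightarrow> ('m, 'n) chart \<Rightarrow>
    complex^'n \<Rightarrow> complex^'n \<Rightarrow> complex" where
  "first_ricci g \<Gamma> c x X =
     (let e = (SOME e. unitary_frame g c x e) in \<Sum>i\<in>UNIV. curv4 g \<Gamma> c x X X (e i) (e i))"

definition mixed_curvature :: "('m, 'n::finite) metric \<Rightarrow> ('m, 'n) christoffel \<Rightarrow> real \<Rightarrow> real \<Rightarrow>
    ('m, 'n) chart \<Rightarrow> complex^'n \<Rightarrow> complex^'n \<Rightarrow> complex" where
  "mixed_curvature g \<Gamma> \<alpha> \<beta> c x X =
     complex_of_real \<alpha> * first_ricci g \<Gamma> c x X + complex_of_real \<beta> * hol_sect_curv g \<Gamma> c x X"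

end

(*
  The argument is pointwise. Let T be the torsion and R the curvature of the Bismut connection.
  Since T is skew and parallel, R acts on T as a derivation, R satisfies the pair symmetry
  R(u,v,w,z) = R(w,z,u,v), and the cyclic sums of R(u,v)w and of T(T(u,v),w) agree.
  The (2,0)-part of T is, up to a factor, the Chern torsion tau, a complex bilinear bracket.
  Let x be the vector dual to the trace w |-> tr tau(w, .). As R(u,v) is a derivation of tau
  commuting with J, it kills x; by pair symmetry R(x, .) = 0, so the Bianchi identity becomes the
  Jacobi identity of tau with one argument x. Taking its trace, tau(x, .) is orthogonal to x, which
  means T(x, Jx) = 0.
  The Chern connection differs from the Bismut connection by a parallel tensor D built from T, so
  the Chern curvature is R(u,v) - D_{T(u,v)} + [D_u, D_v]. At (x, Jx) only the commutator is left;
  it kills x and has trace zero. Hence both H(x) and Ric(x) vanish and c = 0 as soon as x is nonzero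
  at some point.
  If x = 0 at a point then d(omega^(n-1)) = 0 there: this form is the alternation of
  d omega and n-2 copies of omega, and its values on the vectors of a unitary basis are multiples
  of the trace of d omega.
*)
theory Submission
  imports Defs
begin

section \<open>Hermitian linear algebra\<close>

text \<open>Pair symmetry survives the torsion because, for skew T, g(T(T(u,v),w),z) =
  g(T(u,v),T(w,z)); the cyclic sum of this alternates in all four arguments and cancels from the
  usual four-term argument. The vector x is singled out because the curvature side of the Bianchi
  identity vanishes as soon as its first argument is x or Jx; its complex trilinear part is then an
  identity between brackets alone. Ric and H only involve R(X, conj X), which is i/2 times the real
  curvature R(X,JX), so (x,Jx) is the pair to control. Everything happens at one point of one
  holomorphic chart, where J is constant. The obstacle is the balanced condition, which is given by
  explicit sums over permutations: wedge powers and exterior derivative are merged into one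
  unnormalised alternating sum. Among 2n-1 distinct vectors of a symplectic basis exactly one vector
  is missing; its partner cannot be matched by the Kaehler form, hence is an argument of d omega,
  and by counting the other two arguments of d omega are partners of each other.\<close>

lemma J_simps [simp]:
  "J (J v) = - v" "J (- v) = - J v" "J (u + v) = J u + J v" "J (u - v) = J u - J v"
  "J (r *\<^sub>R v) = r *\<^sub>R J v" "J 0 = 0"
  by (simp_all add: vec_eq_iff vector_scalar_mult_def algebra_simps)

lemma vector_smult_eq: "a *s v = Re a *\<^sub>R v + Im a *\<^sub>R J v"
  by (simp add: vec_eq_iff vector_scalar_mult_def complex_eq_iff algebra_simps)

locale hermitian_form =
  fixes g :: "complex^'n::finite \<Rightarrow> complex^'n \<Rightarrow> real"
  assumes bilinear_g: "bilinear g"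
    and g_sym: "g u v = g v u"
    and g_pos: "u \<noteq> 0 \<Longrightarrow> g u u > 0"
    and g_JJ: "g (J u) (J v) = g u v"
begin

lemma g_simps [simp]:
  "g (u + v) w = g u w + g v w" "g w (u + v) = g w u + g w v"
  "g (u - v) w = g u w - g v w" "g w (u - v) = g w u - g w v"
  "g (- u) w = - g u w" "g w (- u) = - g w u"
  "g (r *\<^sub>R u) w = r * g u w" "g w (r *\<^sub>R u) = r * g w u"
  "g 0 w = 0" "g w 0 = 0"
  using bilinear_g
  by (simp_all add: bilinear_ladd bilinear_radd bilinear_lsub bilinear_rsub bilinear_lneg
      bilinear_rneg bilinear_lmul bilinear_rmul bilinear_lzero bilinear_rzero)

lemma g_J_left: "g (J u) v = - g u (J v)"
  using g_JJ[of u "J v"] by simp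

lemma eq_0_if_g_0: "(\<And>v. g u v = 0) \<Longrightarrow> u = 0"
  using g_pos[of u] by fastforce

text \<open>This is \<open>herm\<close> at a fixed point, conjugate linear in the second argument.
  The factor 1/2 gives unit vectors for \<open>h\<close> the squared \<open>g\<close>-length
  2.\<close>

definition h :: "complex^'n \<Rightarrow> complex^'n \<Rightarrow> complex" where
  "h v w = (complex_of_real (g v w) + \<i> * complex_of_real (g v (J w))) / 2"

lemma h_simps [simp]:
  "h (u + v) w = h u w + h v w" "h w (u + v) = h w u + h w v"
  "h (u - v) w = h u w - h v w" "h w (u - v) = h w u - h w v"
  "h (- u) w = - h u w" "h w (- u) = - h w u"
  "h (r *\<^sub>R u) w = of_real r * h u w" "h w (r *\<^sub>R u) = of_real r * h w u"
  "h 0 w = 0" "h w 0 = 0"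
  unfolding h_def by (simp_all add: field_simps)

lemma h_J [simp]: "h (J u) w = \<i> * h u w" "h w (J u) = - \<i> * h w u"
  unfolding h_def by (simp_all add: g_J_left field_simps)

lemma h_smult: "h (a *s u) w = a * h u w" "h w (a *s u) = cnj a * h w u"
  unfolding vector_smult_eq[of a u]
  by (simp_all add: complex_eq_iff algebra_simps)

lemma h_sum: "h (sum f S) w = (\<Sum>i\<in>S. h (f i) w)" "h w (sum f S) = (\<Sum>i\<in>S. h w (f i))"
  by (induction S rule: infinite_finite_induct) auto

lemma h_cnj: "h w v = cnj (h v w)"
proof -
  have "g w (J v) = - g v (J w)" "g w v = g v w"
    using g_J_left[of v w] g_sym[of w "J v"] g_sym[of w v] by linarith+
  then show ?thesis by (simp add: h_def complex_eq_iff)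
qed

lemma h_self: "h v v = of_real (g v v / 2)"
proof -
  have "g v (J v) = 0"
    using g_J_left[of v v] g_sym[of v "J v"] by linarith
  then show ?thesis by (simp add: h_def)
qed

lemma h_self_eq_0: "h v v = 0 \<longleftrightarrow> v = 0"
  using g_pos[of v] by (cases "v = 0") (auto simp: h_self)

lemma Re_h: "Re (h v w) = g v w / 2"
  by (simp add: h_def)

lemma eq_0_if_h_0: "(\<And>v. h v u = 0) \<Longrightarrow> u = 0"
  using h_self_eq_0 by blast

lemma ex_h_normalized:
  assumes "v \<noteq> 0" obtains r where "h (r *\<^sub>R v) (r *\<^sub>R v) = 1" "r \<noteq> 0"
proof
  have p: "g v v > 0" using assms g_pos by blast
  show "h (sqrt (2 / g v v) *\<^sub>R v) (sqrt (2 / g v v) *\<^sub>R v) = 1"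
  proof -
    have "sqrt (2 / g v v) * (sqrt (2 / g v v) * g v v) = 2"
      using p by (metis less_eq_real_def mult.assoc nonzero_eq_divide_eq order_less_irrefl
          real_sqrt_mult_self zero_less_divide_iff zero_less_numeral abs_of_nonneg)
    then show ?thesis by (simp add: h_self)
  qed
  show "sqrt (2 / g v v) \<noteq> 0" using p by simp
qed

text \<open>Relative to an index set, so that a basis can be built up one index at a time.\<close>

definition orthonormal :: "('n \<Rightarrow> complex^'n) \<Rightarrow> 'n set \<Rightarrow> bool" where
  "orthonormal e S \<longleftrightarrow> (\<forall>i\<in>S. \<forall>j\<in>S. h (e i) (e j) = (if i = j then 1 else 0))"

definition projection :: "('n \<Rightarrow> complex^'n) \<Rightarrow> 'n set \<Rightarrow> complex^'n \<Rightarrow> complex^'n" where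
  "projection e S v = (\<Sum>i\<in>S. h v (e i) *s e i)"

lemma orthonormal_sum:
  assumes "orthonormal e S" "j \<in> S"
  shows "(\<Sum>i\<in>S. a i * h (e i) (e j)) = a j"
proof -
  have "(\<Sum>i\<in>S. a i * h (e i) (e j)) = (\<Sum>i\<in>S. if i = j then a i else 0)"
    using assms unfolding orthonormal_def by (intro sum.cong) auto
  then show ?thesis using assms by simp
qed

lemma h_projection: "orthonormal e S \<Longrightarrow> j \<in> S \<Longrightarrow> h (projection e S v) (e j) = h v (e j)"
  unfolding projection_def using orthonormal_sum[of e S j "\<lambda>i. h v (e i)"] by (simp add: h_sum h_smult)

lemma projection_in_span: "projection e S v \<in> vec.span (e ` S)"
  unfolding projection_def by (intro vec.span_sum vec.span_scale vec.span_base) auto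

lemma orthonormal_dim:
  assumes "orthonormal e S"
  shows "vec.dim (e ` S) = card S"
proof -
  have inj: "inj_on e S"
    using assms unfolding orthonormal_def inj_on_def by (metis zero_neq_one)
  have "vec.independent (e ` S)"
    unfolding vec.independent_explicit
  proof (intro conjI allI impI ballI)
    show "finite (e ` S)" by simp
    fix u x assume s: "(\<Sum>v\<in>e ` S. u v *s v) = 0" and x: "x \<in> e ` S"
    then obtain i where i: "i \<in> S" "x = e i" by blast
    have "0 = h (\<Sum>j\<in>S. u (e j) *s e j) (e i)"
      using s by (simp add: sum.reindex[OF inj])
    also have "\<dots> = u (e i)"
      using orthonormal_sum[OF assms i(1), of "\<lambda>j. u (e j)"] by (simp add: h_sum h_smult)
    finally show "u x = 0" using i by simp
  qed
  then show ?thesis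
    using inj by (simp add: vec.dim_eq_card_independent card_image)
qed

text \<open>Gram-Schmidt by induction on \<open>S\<close>: while indices are left, the dimension
  exceeds \<open>card S\<close>, so some vector lies outside the span and has a nonzero residual
  after projection.\<close>

lemma ex_orthonormal: "\<exists>e. orthonormal e S"
proof -
  have "finite S" by simp
  then show ?thesis
  proof induction
    case empty then show ?case by (simp add: orthonormal_def)
  next
    case (insert k S)
    then obtain e where e: "orthonormal e S" by blast
    have "vec.span (e ` S) \<noteq> UNIV"
    proof
      assume "vec.span (e ` S) = UNIV"
      then have "vec.dim (e ` S) = CARD('n)"
        by (metis vec.dim_span vec.dim_UNIV vec_dim_card)
      moreover have "card S < CARD('n)"
        using insert by (intro psubset_card_mono) auto
      ultimately show False using orthonormal_dim[OF e] by simp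
    qed
    then obtain y where y: "y \<notin> vec.span (e ` S)" by blast
    define z where "z = y - projection e S y"
    have "z \<noteq> 0" using y projection_in_span[of e S y] unfolding z_def by auto
    then obtain r where r: "h (r *\<^sub>R z) (r *\<^sub>R z) = 1" using ex_h_normalized by blast
    have o: "h z (e j) = 0" if "j \<in> S" for j
      using h_projection[OF e that] by (simp add: z_def)
    then have o': "h (e j) z = 0" if "j \<in> S" for j
      using that h_cnj[of "e j" z] by simp
    have "orthonormal (e(k := r *\<^sub>R z)) (insert k S)"
      using e r o o' insert(2) unfolding orthonormal_def by auto
    then show ?case by blast
  qed
qed

text \<open>The residual \<open>v - projection e UNIV v\<close> is orthogonal to every
  \<open>e i\<close>, hence to their span, which is the whole space by dimension; so it is
  orthogonal to itself.\<close>

lemma orthonormal_expansion: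
  assumes "orthonormal e UNIV"
  shows "(\<Sum>i\<in>UNIV. h v (e i) *s e i) = v"
proof -
  have "vec.dim (UNIV :: (complex^'n) set) \<le> vec.dim (range e)"
    by (rule eq_refl, rule trans[OF vec_dim_card orthonormal_dim[OF assms, symmetric]])
  then have "vec.span (range e) = vec.span UNIV"
    by (rule vec.dim_eq_span[OF subset_UNIV])
  then have span: "v - projection e UNIV v \<in> vec.span (range e)" by simp
  have o: "h (e i) (v - projection e UNIV v) = 0" for i
  proof -
    have "h (v - projection e UNIV v) (e i) = 0" by (simp add: h_projection[OF assms])
    then show ?thesis by (metis h_cnj complex_cnj_zero)
  qed
  have "h y (v - projection e UNIV v) = 0" if "y \<in> vec.span (range e)" for y
    using that
  proof (induction rule: vec.span_induct_alt)
    case (step c x y)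
    then obtain i where "x = e i" by blast
    then show ?case using step o[of i] by (simp only: h_simps(1) h_smult) simp
  qed (simp only: h_simps(9))
  then have "v - projection e UNIV v = 0" using span h_self_eq_0 by blast
  then show ?thesis by (simp add: projection_def)
qed

end

section \<open>Traces of complex linear maps\<close>

definition complex_linear :: "(complex^'n \<Rightarrow> complex^'n) \<Rightarrow> bool" where
  "complex_linear A \<longleftrightarrow> linear A \<and> (\<forall>v. A (J v) = J (A v))"

lemma complex_linear_smult: "complex_linear A \<Longrightarrow> A (a *s v) = a *s A v"
  unfolding complex_linear_def vector_smult_eq[of a v] vector_smult_eq[of a "A v"]
  by (simp add: linear_add linear_scale)

lemma complex_linear_sum: "complex_linear A \<Longrightarrow> A (sum f S) = (\<Sum>i\<in>S. A (f i))"
  unfolding complex_linear_def by (simp add: linear_sum)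

context hermitian_form
begin

text \<open>In the basis \<open>e\<close> both sides are the same double sum of products of matrix
  entries. Its purpose is to make traces of commutators vanish.\<close>

lemma trace_commute:
  assumes e: "orthonormal e UNIV" and A: "complex_linear A" and B: "complex_linear B"
  shows "(\<Sum>i\<in>UNIV. h (A (B (e i))) (e i)) = (\<Sum>i\<in>UNIV. h (B (A (e i))) (e i))"
proof -
  have ex: "h (A (B (e i))) (e i) = (\<Sum>j\<in>UNIV. h (B (e i)) (e j) * h (A (e j)) (e i))"
    if "complex_linear A" for A B i
  proof -
    have "h (A (B (e i))) (e i) = h (A (\<Sum>j\<in>UNIV. h (B (e i)) (e j) *s e j)) (e i)"
      by (simp only: orthonormal_expansion[OF e])
    also have "\<dots> = (\<Sum>j\<in>UNIV. h (B (e i)) (e j) * h (A (e j)) (e i))"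
      by (simp only: complex_linear_sum[OF that] complex_linear_smult[OF that] h_sum h_smult)
    finally show ?thesis .
  qed
  show ?thesis
    unfolding ex[OF A, of B] ex[OF B, of A] by (subst sum.swap) (simp only: mult.commute)
qed

end

section \<open>Parallel skew torsion at a point\<close>

text \<open>Bismut torsion and curvature at one point. \<open>T_type\<close> says that
  \<open>T\<close> has no part that is conjugate linear in both arguments, which reflects the
  integrability of \<open>J\<close>. \<open>R_torsion\<close> is what parallelism of the torsion
  leaves at a point.\<close>

locale parallel_torsion = hermitian_form g
  for g :: "complex^'n::finite \<Rightarrow> complex^'n \<Rightarrow> real" +
  fixes T :: "complex^'n \<Rightarrow> complex^'n \<Rightarrow> complex^'n"
    and R :: "complex^'n \<Rightarrow> complex^'n \<Rightarrow> complex^'n \<Rightarrow> complex^'n"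
  assumes bilinear_T: "bilinear T"
    and T_skew: "T u v = - T v u"
    and T_skew3: "g (T u v) w = - g (T u w) v"
    and T_type: "T (J u) (J v) - T u v = J (T (J u) v) + J (T u (J v))"
    and R_skew: "R u v w = - R v u w"
    and R_metric: "g (R u v w) z = - g (R u v z) w"
    and R_J: "R u v (J w) = J (R u v w)"
    and R_torsion: "R u v (T w z) = T (R u v w) z + T w (R u v z)"
    and bianchi: "R u v w + R v w u + R w u v = T (T u v) w + T (T v w) u + T (T w u) v"
begin

lemma T_simps [simp]:
  "T (u + v) w = T u w + T v w" "T w (u + v) = T w u + T w v"
  "T (u - v) w = T u w - T v w" "T w (u - v) = T w u - T w v"
  "T (- u) w = - T u w" "T w (- u) = - T w u"
  "T (r *\<^sub>R u) w = r *\<^sub>R T u w" "T w (r *\<^sub>R u) = r *\<^sub>R T w u"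
  "T 0 w = 0" "T w 0 = 0"
  using bilinear_T
  by (simp_all add: bilinear_ladd bilinear_radd bilinear_lsub bilinear_rsub bilinear_lneg
      bilinear_rneg bilinear_lmul bilinear_rmul bilinear_lzero bilinear_rzero)

lemma T_self [simp]: "T u u = 0"
  using T_skew[of u u] by (simp add: eq_neg_iff_add_eq_0 scaleR_2[symmetric])

text \<open>Additivity and real homogeneity come from \<open>R_metric\<close>, which moves the
  argument of \<open>R u v\<close> into a linear slot of \<open>g\<close>.\<close>

lemma complex_linear_R: "complex_linear (R u v)"
  unfolding complex_linear_def
proof (intro conjI allI linearI)
  fix w z r
  have "R u v (w + z) - R u v w - R u v z = 0"
    by (rule eq_0_if_g_0) (simp add: R_metric[of u v "w + z"] R_metric[of u v w] R_metric[of u v z])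
  then show "R u v (w + z) = R u v w + R u v z" by (simp add: algebra_simps)
  show "R u v (r *\<^sub>R w) = r *\<^sub>R R u v w"
    using eq_0_if_g_0[of "R u v (r *\<^sub>R w) - r *\<^sub>R R u v w"]
    by (simp add: R_metric[of u v "r *\<^sub>R w"] R_metric[of u v w])
qed (rule R_J)

text \<open>The classical argument for Riemannian curvature with an error term: the Bianchi sum is
  \<open>F\<close> instead of 0, but \<open>F\<close> is alternating in its four arguments.\<close>

lemma R_pair: "g (R u v w) z = g (R w z u) v"
proof -
  define q where "q a b c d = g (T a b) (T c d)" for a b c d
  have q: "q a b c d = q c d a b" "q a b c d = - q b a c d" for a b c d
    unfolding q_def using T_skew[of a b] by (simp_all add: g_sym)
  define F where "F u v w z = q u v w z + q v w u z + q w u v z" for u v w z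
  \<comment> \<open>Skewness moves the outer \<open>T\<close> across \<open>g\<close>, so the
    right-hand side of \<open>bianchi\<close> becomes a cyclic sum of \<open>q\<close>.\<close>
  have "g (T (T a b) c) d = q a b c d" for a b c d
    unfolding q_def
    using T_skew[of "T a b" c] T_skew3[of c "T a b" d] g_sym[of "T c d" "T a b"] by simp
  then have b: "F u v w z = g (R u v w) z + g (R v w u) z + g (R w u v) z" for u v w z
    unfolding F_def using arg_cong[OF bianchi[of u v w], of "\<lambda>x. g x z"] by simp
  have F1: "F u v w z = F v w u z" for u v w z unfolding F_def by simp
  have F3: "F u v w z = - F u v z w" for u v w z
    unfolding F_def
    using q(1)[of u v w z] q(1)[of u v z w] q(2)[of w z u v] q(1)[of v z u w] q(2)[of u w v z]
      q(1)[of z u v w] q(2)[of z u v w] q(1)[of u z v w] q(2)[of w u v z] q(1)[of v w u z]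
    by linarith
  have F2: "F u v w z = - F v u w z" for u v w z
    unfolding F_def using q(2)[of u v w z] q(2)[of v w u z] q(2)[of w u v z] by linarith
  have 1: "g (R u v w) z = - g (R v u w) z" for u v w z
    using arg_cong[OF R_skew[of u v w], of "\<lambda>x. g x z"] by simp
  have cyc: "F v w z u = - F u v w z" for u v w z
    using F3[of v w z u] F1[of u v w z] F1[of v w u z] F2[of v w u z] by linarith
  \<comment> \<open>The Bianchi sums of the four cyclic shifts, taken with signs +, +, -, -, add up
    to twice the difference of the two sides. A cyclic shift of four arguments changes the sign of
    \<open>F\<close>, so the \<open>F\<close> terms cancel.\<close>
  show ?thesis
    using b[of u v w z] b[of v w z u] b[of w z u v] b[of z u v w]
      cyc[of u v w z] cyc[of v w z u] cyc[of w z u v]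
      R_metric[of u v w z] R_metric[of v w u z] R_metric[of w z v u] R_metric[of z u w v]
      1[of w u v z] R_metric[of u w v z] 1[of z v w u] R_metric[of v z w u]
    by linarith
qed

text \<open>By \<open>T_type\<close>, this is exactly the torsion of the connection obtained from
  the Bismut connection by subtracting \<open>chern_difference\<close>; it is minus the complex
  bilinear part of \<open>T\<close>.\<close>

definition chern_torsion :: "complex^'n \<Rightarrow> complex^'n \<Rightarrow> complex^'n" where
  "chern_torsion u v = (1 / 2) *\<^sub>R (T (J u) (J v) - T u v)"

lemma chern_torsion_simps [simp]:
  "chern_torsion (u + v) w = chern_torsion u w + chern_torsion v w"
  "chern_torsion w (u + v) = chern_torsion w u + chern_torsion w v"
  "chern_torsion (- u) w = - chern_torsion u w" "chern_torsion w (- u) = - chern_torsion w u"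
  "chern_torsion (r *\<^sub>R u) w = r *\<^sub>R chern_torsion u w"
  "chern_torsion w (r *\<^sub>R u) = r *\<^sub>R chern_torsion w u"
  unfolding chern_torsion_def by (simp_all add: algebra_simps)

lemma chern_torsion_skew: "chern_torsion u v = - chern_torsion v u"
  unfolding chern_torsion_def using T_skew[of u v] T_skew[of "J u" "J v"]
  by (simp add: algebra_simps)

lemma T_type': "T (J u) v + T u (J v) = J (T u v - T (J u) (J v))"
proof -
  have "J (T (J u) (J v) - T u v) = - (T (J u) v + T u (J v))"
    by (subst T_type) simp
  then show ?thesis by (simp add: algebra_simps)
qed

lemma chern_torsion_J_left [simp]: "chern_torsion (J u) v = J (chern_torsion u v)"
proof -
  have "T (J u) v + T u (J v) = J (T u v) - J (T (J u) (J v))"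
    using T_type'[of u v] by simp
  then have "- T u (J v) - T (J u) v = J (T (J u) (J v)) - J (T u v)"
    by (simp add: algebra_simps)
  then show ?thesis by (simp add: chern_torsion_def)
qed

lemma chern_torsion_J_right [simp]: "chern_torsion u (J v) = J (chern_torsion u v)"
  using chern_torsion_skew[of u "J v"] chern_torsion_skew[of u v] by simp

lemma complex_linear_chern_torsion:
  "complex_linear (chern_torsion u)" "complex_linear (\<lambda>u. chern_torsion u v)"
  unfolding complex_linear_def by (auto intro!: linearI)

text \<open>
  The real part of the value of the complex trilinear extension of \<open>T (T u v) w\<close> on the vectors
  \<open>u - iJu\<close>, \<open>v - iJv\<close>, \<open>w - iJw\<close>.
\<close>

lemma T_T_type:
  "T (T u v) w - T (T (J u) (J v)) w - T (T (J u) v) (J w) - T (T u (J v)) (J w) =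
    4 *\<^sub>R chern_torsion (chern_torsion u v) w"
proof -
  have "T (T u v) w - T (T (J u) (J v)) w - T (T (J u) v) (J w) - T (T u (J v)) (J w) =
    T (T u v - T (J u) (J v)) w - T (T (J u) v + T u (J v)) (J w)"
    by simp
  also have "\<dots> = - 2 *\<^sub>R chern_torsion (T u v - T (J u) (J v)) w"
    unfolding T_type' unfolding chern_torsion_def by (simp add: algebra_simps)
  also have "T u v - T (J u) (J v) = - 2 *\<^sub>R chern_torsion u v"
    unfolding chern_torsion_def by (simp add: algebra_simps)
  finally show ?thesis by simp
qed

text \<open>\<open>chern_torsion\<close> is made of \<open>T\<close> and \<open>J\<close>, and
  \<open>R u v\<close> respects both.\<close>

lemma R_chern_torsion:
  "R u v (chern_torsion w z) = chern_torsion (R u v w) z + chern_torsion w (R u v z)"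
proof -
  have "linear (R u v)" using complex_linear_R complex_linear_def by blast
  then show ?thesis
    unfolding chern_torsion_def
    by (simp add: linear_diff linear_scale R_torsion R_J algebra_simps)
qed

text \<open>Pair symmetry turns a vector killed in the third slot into one killed in the
  first.\<close>

lemma R_parallel_left: "(\<And>u v. R u v x = 0) \<Longrightarrow> R x v w = 0"
  using R_pair[of x v w] by (intro eq_0_if_g_0) simp

text \<open>The complex trilinear part of \<open>bianchi\<close>: in the four-term combination every
  \<open>F\<close> has \<open>x\<close> or \<open>J x\<close> as first argument, so the curvature
  side vanishes, while \<open>T_T_type\<close>, applied to each term of the cyclic sum, leaves
  iterated brackets. The Jacobi identity is stated as a commutator so that its trace can be
  taken.\<close>

lemma jacobi_parallel:
  assumes "\<And>u v. R u v x = 0"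
  shows "chern_torsion (chern_torsion x v) w =
    chern_torsion x (chern_torsion v w) - chern_torsion v (chern_torsion x w)"
proof -
  define F where "F u v w = T (T u v) w + T (T v w) u + T (T w u) v" for u v w
  have F0: "F y v w = 0" if "\<And>u v. R u v y = 0" for y v w
    unfolding F_def bianchi[symmetric]
    using that R_parallel_left[OF that] R_skew[of w y v] by simp
  have RJ: "R u v (J x) = 0" for u v by (simp add: R_J assms)
  have "4 *\<^sub>R (chern_torsion (chern_torsion x v) w + chern_torsion (chern_torsion v w) x +
      chern_torsion (chern_torsion w x) v) =
    F x v w - F (J x) (J v) w - F (J x) v (J w) - F x (J v) (J w)"
    unfolding scaleR_add_right T_T_type[symmetric] F_def by (simp add: algebra_simps)
  also have "\<dots> = 0" by (simp add: F0 assms RJ)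
  finally have "chern_torsion (chern_torsion x v) w + chern_torsion (chern_torsion v w) x +
      chern_torsion (chern_torsion w x) v = 0" by simp
  moreover have "chern_torsion (chern_torsion v w) x = - chern_torsion x (chern_torsion v w)"
    by (rule chern_torsion_skew)
  moreover have "chern_torsion (chern_torsion w x) v = chern_torsion v (chern_torsion x w)"
    by (subst chern_torsion_skew, subst chern_torsion_skew[of w x]) simp
  ultimately show ?thesis by (simp add: algebra_simps)
qed

text \<open>The torsion 1-form of the Chern connection, up to normalisation.\<close>

definition lee_form :: "('n \<Rightarrow> complex^'n) \<Rightarrow> complex^'n \<Rightarrow> complex" where
  "lee_form e w = (\<Sum>i\<in>UNIV. h (chern_torsion w (e i)) (e i))"

text \<open>The vector dual to \<open>lee_form e\<close>; the conjugate compensates the conjugate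
  linearity of \<open>h\<close> in its second argument.\<close>

definition lee_vector :: "('n \<Rightarrow> complex^'n) \<Rightarrow> complex^'n" where
  "lee_vector e = (\<Sum>i\<in>UNIV. cnj (lee_form e (e i)) *s e i)"

lemma h_lee_vector:
  assumes "orthonormal e UNIV"
  shows "h v (lee_vector e) = lee_form e v"
proof -
  have "lee_form e v = lee_form e (\<Sum>i\<in>UNIV. h v (e i) *s e i)"
    using orthonormal_expansion[OF assms, of v] by simp
  also have "\<dots> = (\<Sum>i\<in>UNIV. h v (e i) * lee_form e (e i))"
    unfolding lee_form_def complex_linear_sum[OF complex_linear_chern_torsion(2)]
      complex_linear_smult[OF complex_linear_chern_torsion(2)] h_sum h_smult sum_distrib_left
    by (rule sum.swap)
  also have "\<dots> = h v (lee_vector e)"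
    unfolding lee_vector_def h_sum h_smult by (simp add: mult.commute)
  finally show ?thesis by simp
qed

text \<open>By the derivation property, \<open>lee_form e (R u v w)\<close> is the trace of the
  commutator of \<open>R u v\<close> and \<open>chern_torsion w\<close>, hence 0. As
  \<open>R u v\<close> is skew for \<open>h\<close>, it can be moved over to the Lee vector.\<close>

lemma R_lee_vector:
  assumes e: "orthonormal e UNIV"
  shows "R u v (lee_vector e) = 0"
proof (rule eq_0_if_h_0)
  fix w
  have "lee_form e (R u v w) =
      (\<Sum>i\<in>UNIV. h (R u v (chern_torsion w (e i))) (e i)) -
      (\<Sum>i\<in>UNIV. h (chern_torsion w (R u v (e i))) (e i))"
    unfolding lee_form_def R_chern_torsion by (simp add: sum.distrib)
  then have 0: "h (R u v w) (lee_vector e) = 0"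
    using trace_commute[OF e complex_linear_R complex_linear_chern_torsion(1)] h_lee_vector[OF e]
    by simp
  have "h w (R u v z) = - h (R u v w) z" for z
    unfolding h_def using R_metric[of u v w z] R_metric[of u v w "J z"]
    by (simp add: g_sym[of w] R_J add.commute[of "- _"] field_simps)
  then show "h w (R u v (lee_vector e)) = 0" using 0 by simp
qed

text \<open>By \<open>jacobi_parallel\<close> the map
  \<open>chern_torsion (chern_torsion x w)\<close> is a commutator and has trace 0; by duality,
  \<open>chern_torsion x w\<close> is orthogonal to \<open>x\<close>.\<close>

lemma T_lee_vector:
  assumes e: "orthonormal e UNIV"
  shows "T (lee_vector e) (J (lee_vector e)) = 0"
proof (rule eq_0_if_g_0)
  fix w
  let ?x = "lee_vector e"
  have "lee_form e (chern_torsion ?x w) = 0"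
    unfolding lee_form_def jacobi_parallel[OF R_lee_vector[OF e]]
    using trace_commute[OF e complex_linear_chern_torsion(1) complex_linear_chern_torsion(1)]
    by (simp add: sum_subtractf)
  then have "h (chern_torsion ?x w) (J ?x) = 0"
    using h_lee_vector[OF e] by simp
  then have "g (chern_torsion ?x w) (J ?x) = 0"
    using Re_h[of "chern_torsion ?x w" "J ?x"] by simp
  \<comment> \<open>Of the two terms of \<open>chern_torsion ?x w\<close>, this one pairs to 0 with
    \<open>J ?x\<close> by skewness; what remains is the claim.\<close>
  moreover have "g (T (J ?x) (J w)) (J ?x) = 0"
    using T_skew3[of "J ?x" "J w" "J ?x"] by simp
  ultimately show "g (T ?x (J ?x)) w = 0"
    using T_skew3[of ?x w "J ?x"] by (simp add: chern_torsion_def)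
qed

text \<open>The bridge to the balanced condition: the real part of \<open>lee_form e (J w)\<close>
  is a quarter of this sum, one factor 1/2 coming from \<open>Re_h\<close> and one from
  \<open>chern_torsion\<close>.\<close>

lemma trace_T_J:
  assumes e: "orthonormal e UNIV" and "lee_vector e = 0"
  shows "(\<Sum>i\<in>UNIV. g (T (e i) (J (e i))) w) = 0"
proof -
  have "0 = Re (lee_form e (J w))"
    using h_lee_vector[OF e, of "J w"] assms(2) by simp
  also have "\<dots> = (\<Sum>i\<in>UNIV. Re (h (chern_torsion (J w) (e i)) (e i)))"
    unfolding lee_form_def by (rule Re_sum)
  also have "\<dots> = (\<Sum>i\<in>UNIV. g (T (e i) (J (e i))) w / 4)"
  proof (rule sum.cong)
    fix i
    have "g (T (J w) (e i)) (e i) = 0" using T_skew3[of "J w" "e i" "e i"] by simp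
    moreover have "g (T w (J (e i))) (e i) = - g (T (e i) (J (e i))) w"
      using T_skew[of w "J (e i)"] T_skew3[of "J (e i)" w "e i"] T_skew[of "e i" "J (e i)"] by simp
    ultimately show "Re (h (chern_torsion (J w) (e i)) (e i)) = g (T (e i) (J (e i))) w / 4"
      unfolding Re_h by (simp add: chern_torsion_def)
  qed simp
  finally show ?thesis by (simp flip: sum_divide_distrib)
qed

text \<open>The Chern connection is the Bismut connection minus this tensor.\<close>

definition chern_difference :: "complex^'n \<Rightarrow> complex^'n \<Rightarrow> complex^'n" where
  "chern_difference u v = (1 / 2) *\<^sub>R (T u v - J (T u (J v)))"

lemma complex_linear_chern_difference: "complex_linear (chern_difference u)"
  unfolding complex_linear_def chern_difference_def
  by (auto intro!: linearI simp: algebra_simps)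

definition chern_curvature ::
    "complex^'n \<Rightarrow> complex^'n \<Rightarrow> complex^'n \<Rightarrow> complex^'n" where
  "chern_curvature u v w = R u v w - chern_difference (T u v) w +
    chern_difference u (chern_difference v w) - chern_difference v (chern_difference u w)"

lemma chern_curvature_flat:
  assumes e: "orthonormal e UNIV" and R: "\<And>u v. R u v x = 0" and T: "T x (J x) = 0"
  shows "chern_curvature x (J x) x = 0"
    and "(\<Sum>i\<in>UNIV. h (chern_curvature x (J x) (e i)) (e i)) = 0"
proof -
  have "chern_difference 0 w = 0" for w by (simp add: chern_difference_def)
  then have c: "chern_curvature x (J x) w =
      chern_difference x (chern_difference (J x) w) - chern_difference (J x) (chern_difference x w)"
    for w
    unfolding chern_curvature_def by (simp add: T R_parallel_left[OF R])
  \<comment> \<open>Up to sign and \<open>J\<close>, the first two are half of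
    \<open>T x (J x)\<close>.\<close>
  have "chern_difference x x = 0" "chern_difference (J x) x = 0" "chern_difference u 0 = 0" for u
    using T T_skew[of "J x" x] by (simp_all add: chern_difference_def)
  then show "chern_curvature x (J x) x = 0" unfolding c by simp
  show "(\<Sum>i\<in>UNIV. h (chern_curvature x (J x) (e i)) (e i)) = 0"
    unfolding c
    using trace_commute[OF e complex_linear_chern_difference complex_linear_chern_difference]
    by (simp add: sum_subtractf)
qed

end

section \<open>Alternation\<close>

text \<open>Unnormalised: powers of the Kaehler form and their exterior derivative are both brought
  into this form, with the factorials of \<open>wedge\<close> collected in front.\<close>

definition alternation :: "nat \<Rightarrow> 'a form \<Rightarrow> 'a form" where
  "alternation k F v = (\<Sum>p | p permutes {..<k}. of_int (sign p) * F (\<lambda>i. v (p i)))"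

lemma alternation_cong: "(\<And>w. F w = G w) \<Longrightarrow> alternation k F v = alternation k G v"
  by (simp add: alternation_def)

lemma alternation_sum: "alternation k (\<lambda>w. \<Sum>j\<in>S. F j w) v = (\<Sum>j\<in>S. alternation k (F j) v)"
  unfolding alternation_def by (simp add: sum_distrib_left) (rule sum.swap)

lemma sum_sign_compose_right:
  fixes f :: "(nat \<Rightarrow> nat) \<Rightarrow> real"
  assumes q: "q permutes {..<k}"
  shows "(\<Sum>p | p permutes {..<k}. of_int (sign p) * f (p \<circ> q)) =
         of_int (sign q) * (\<Sum>p | p permutes {..<k}. of_int (sign p) * f p)"
proof -
  have "permutation p" if "p permutes {..<k}" for p
    using that permutation_permutes by blast
  then have s: "sign (p \<circ> q) = sign p * sign q" if "p permutes {..<k}" for p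
    using that q sign_compose by blast
  have "(\<Sum>p | p permutes {..<k}. of_int (sign p) * f p) =
      (\<Sum>p | p permutes {..<k}. of_int (sign (p \<circ> q)) * f (p \<circ> q))"
    by (rule sum_permutations_compose_right[OF q])
  also have "\<dots> = (\<Sum>p | p permutes {..<k}. of_int (sign q) * (of_int (sign p) * f (p \<circ> q)))"
    by (rule sum.cong) (auto simp: s)
  finally have "of_int (sign q) * (\<Sum>p | p permutes {..<k}. of_int (sign p) * f p) =
    of_int (sign q * sign q) * (\<Sum>p | p permutes {..<k}. of_int (sign p) * f (p \<circ> q))"
    by (simp only: sum_distrib_left of_int_mult mult.assoc)
  then show ?thesis by simp
qed

lemma alternation_permute:
  assumes "q permutes {..<k}"
  shows "alternation k (\<lambda>w. F (\<lambda>i. w (q i))) v = of_int (sign q) * alternation k F v"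
  unfolding alternation_def
  using sum_sign_compose_right[OF assms, of "\<lambda>p. F (\<lambda>i. v (p i))"] by simp

lemma alternation_permute_args:
  assumes q: "q permutes {..<k}"
  shows "alternation k F (\<lambda>i. v (q i)) = of_int (sign q) * alternation k F v"
proof -
  have s: "sign (q \<circ> p) = sign q * sign p" if "p permutes {..<k}" for p
    using that q sign_compose permutation_permutes by blast
  have "alternation k F v = (\<Sum>p | p permutes {..<k}. of_int (sign (q \<circ> p)) * F (\<lambda>i. v ((q \<circ> p) i)))"
    unfolding alternation_def by (rule setum_permutations_compose_left[OF q])
  also have "\<dots> = (\<Sum>p | p permutes {..<k}. of_int (sign q) * (of_int (sign p) * F (\<lambda>i. v (q (p i)))))"
    by (rule sum.cong) (auto simp: s)
  finally have "of_int (sign q) * alternation k F v =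
      of_int (sign q * sign q) * alternation k F (\<lambda>i. v (q i))"
    unfolding alternation_def by (simp only: sum_distrib_left of_int_mult mult.assoc)
  then show ?thesis by simp
qed

lemma alternation_repeated:
  assumes "i < k" "j < k" "i \<noteq> j" "v i = v j"
  shows "alternation k F v = 0"
proof -
  have t: "Transposition.transpose i j permutes {..<k}"
    using assms by (intro permutes_swap_id) auto
  have "(\<lambda>l. v (Transposition.transpose i j l)) = v"
    using assms by (auto simp: Transposition.transpose_def)
  then show ?thesis
    using alternation_permute_args[OF t, of F v] assms by (simp add: sign_swap_id)
qed

lemma sum_permutes_image:
  assumes f: "inj_on f S"
  shows "(\<Sum>q | q permutes f ` S. F q) = (\<Sum>q | q permutes S. F (map_permutation S f q))"
proof -
  have b: "bij_betw f S (f ` S)" using f by (simp add: bij_betw_def)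
  have b': "bij_betw (inv_into S f) (f ` S) S" using b by (rule bij_betw_inv_into)
  show ?thesis
  proof (rule sum.reindex_bij_witness[of _ "map_permutation S f" "map_permutation (f ` S) (inv_into S f)"])
    fix q assume "q \<in> {q. q permutes f ` S}"
    then show "map_permutation S f (map_permutation (f ` S) (inv_into S f) q) = q"
      "map_permutation (f ` S) (inv_into S f) q \<in> {q. q permutes S}"
      using map_permutation_compose_inv[OF b', of q f] map_permutation_permutes[OF b']
      by (auto simp: f_inv_into_f)
    then show "F (map_permutation S f (map_permutation (f ` S) (inv_into S f) q)) = F q" by simp
  next
    fix q assume "q \<in> {q. q permutes S}"
    then show "map_permutation (f ` S) (inv_into S f) (map_permutation S f q) = q"
      "map_permutation S f q \<in> {q. q permutes f ` S}"
      using map_permutation_compose_inv[OF b, of q "inv_into S f"] map_permutation_permutes[OF b]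
      by (auto simp: f)
  qed
qed

text \<open>An inner permutation \<open>q\<close> extends, with the same sign, to one that moves
  only the last \<open>l\<close> slots, and the outer alternation absorbs it. So all
  \<open>fact l\<close> inner permutations contribute equally.\<close>

lemma alternation_tensor_alternation:
  assumes dep: "\<And>v w. (\<And>i. i < k \<Longrightarrow> v i = w i) \<Longrightarrow> a v = a w"
    and depb: "\<And>v w. (\<And>i. i < l \<Longrightarrow> v i = w i) \<Longrightarrow> b v = b w"
  shows "alternation (k + l) (\<lambda>w. a w * alternation l b (\<lambda>i. w (k + i))) v =
    fact l * alternation (k + l) (\<lambda>w. a w * b (\<lambda>i. w (k + i))) v"
proof -
  have inj: "inj_on ((+) k) {..<l}" by simp
  have "alternation (k + l) (\<lambda>w. a w * alternation l b (\<lambda>i. w (k + i))) v =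
    (\<Sum>q | q permutes {..<l}. of_int (sign q) *
      alternation (k + l) (\<lambda>w. a w * b (\<lambda>i. w (k + q i))) v)"
    unfolding alternation_def
    by (simp add: sum_distrib_left, subst sum.swap) (simp add: mult_ac)
  also have "\<dots> = (\<Sum>q | q permutes {..<l}. alternation (k + l) (\<lambda>w. a w * b (\<lambda>i. w (k + i))) v)"
  proof (intro sum.cong refl)
    fix q assume "q \<in> {q. q permutes {..<l}}"
    then have q: "q permutes {..<l}" by simp
    let ?q = "map_permutation {..<l} ((+) k) q"
    have "?q permutes ((+) k) ` {..<l}"
      using q by (intro map_permutation_permutes) (auto simp: bij_betw_def)
    then have qp: "?q permutes {..<k + l}"
      by (rule permutes_subset) auto
    have s: "sign ?q = sign q" using q by (intro sign_map_permutation) auto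
    have 1: "?q i = i" if "i < k" for i
      using that \<open>?q permutes ((+) k) ` {..<l}\<close> by (intro permutes_not_in) auto
    have 2: "?q (k + i) = k + q i" if "i < l" for i
      using that map_permutation_apply[OF inj] by simp
    have "a w = a (\<lambda>i. w (?q i))" "b (\<lambda>i. w (k + q i)) = b (\<lambda>i. w (?q (k + i)))" for w
      by (rule dep, simp add: 1) (rule depb, simp add: 2)
    then have "alternation (k + l) (\<lambda>w. a w * b (\<lambda>i. w (k + q i))) v =
      alternation (k + l) (\<lambda>w. a (\<lambda>i. w (?q i)) * b (\<lambda>i. w (?q (k + i)))) v"
      by (intro alternation_cong) presburger
    also have "\<dots> = of_int (sign q) * alternation (k + l) (\<lambda>w. a w * b (\<lambda>i. w (k + i))) v"
      using alternation_permute[OF qp, of "\<lambda>w. a w * b (\<lambda>i. w (k + i))" v] by (simp add: s)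
    finally show "of_int (sign q) * alternation (k + l) (\<lambda>w. a w * b (\<lambda>i. w (k + q i))) v =
      alternation (k + l) (\<lambda>w. a w * b (\<lambda>i. w (k + i))) v"
      by (simp flip: mult.assoc of_int_mult)
  qed
  finally show ?thesis by (simp add: card_permutations)
qed

text \<open>Each \<open>wedge\<close> divides by \<open>fact 2 * fact (2 * m)\<close>; the second
  factor cancels against the one from \<open>alternation_tensor_alternation\<close>, which leaves
  1/2 for each step.\<close>

lemma wedge_power_2:
  "wedge_power 2 (\<lambda>v. \<omega> (v 0) (v 1)) m v =
    alternation (2 * m) (\<lambda>w. \<Prod>i<m. \<omega> (w (2 * i)) (w (2 * i + 1))) v / 2 ^ m"
proof (induction m arbitrary: v)
  case 0
  then show ?case by (simp add: alternation_def)
next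
  case (Suc m)
  let ?b = "\<lambda>w. \<Prod>i<m. \<omega> (w (2 * i)) (w (2 * i + 1))"
  have "wedge_power 2 (\<lambda>v. \<omega> (v 0) (v 1)) (Suc m) v =
    alternation (2 + 2 * m) (\<lambda>w. \<omega> (w 0) (w 1) * alternation (2 * m) ?b (\<lambda>i. w (2 + i))) v /
      (2 * fact (2 * m) * 2 ^ m)"
    unfolding wedge_power.simps wedge_def Suc
    by (simp add: alternation_def field_simps flip: sum_divide_distrib)
  also have "\<dots> = alternation (2 + 2 * m) (\<lambda>w. \<omega> (w 0) (w 1) * ?b (\<lambda>i. w (2 + i))) v / 2 ^ Suc m"
    by (subst alternation_tensor_alternation) (auto intro!: prod.cong)
  also have "(\<lambda>w. \<omega> (w 0) (w 1) * ?b (\<lambda>i. w (2 + i))) =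
      (\<lambda>w. \<Prod>i<Suc m. \<omega> (w (2 * i)) (w (2 * i + 1)))"
    by (subst prod.lessThan_Suc_shift) simp
  finally show ?case by simp
qed

text \<open>The left-hand side has the shape of \<open>ext_deriv\<close>. Its index \<open>i\<close>
  runs over the cosets of the permutations fixing 0, each represented by a cycle of sign
  \<open>(-1) ^ i\<close>.\<close>

lemma sum_skip_alternation:
  fixes F :: "'a \<Rightarrow> 'a form"
  assumes dep: "\<And>x v w. (\<And>i. i < k \<Longrightarrow> v i = w i) \<Longrightarrow> F x v = F x w"
  shows "(\<Sum>i\<le>k. (-1) ^ i * alternation k (F (v i)) (\<lambda>j. if j < i then v j else v (Suc j))) =
    alternation (Suc k) (\<lambda>w. F (w 0) (\<lambda>j. w (Suc j))) v"
proof -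
  \<comment> \<open>The cycle 0 -> i, 1 -> 0, ..., i -> i - 1, so that \<open>c i (Suc j)\<close> is
    the \<open>j\<close>-th index once \<open>i\<close> has been left out.\<close>
  define c where "c i j = (if j = 0 then i else if j \<le> i then j - 1 else j)" for i j :: nat
  have c_Suc: "c (Suc i) = Transposition.transpose i (Suc i) \<circ> c i" for i
    by (auto simp: c_def fun_eq_iff Transposition.transpose_def)
  have c0: "c 0 = id" by (auto simp: c_def fun_eq_iff)
  have c_perm: "c i permutes {..<Suc k} \<and> sign (c i) = (-1) ^ i" if "i \<le> k" for i
    using that
  proof (induction i)
    case (Suc i)
    then have IH: "c i permutes {..<Suc k}" "sign (c i) = (-1) ^ i" by auto
    have t: "Transposition.transpose i (Suc i) permutes {..<Suc k}"
      using Suc by (intro permutes_swap_id) auto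
    show ?case
    proof
      show "c (Suc i) permutes {..<Suc k}"
        unfolding c_Suc by (rule permutes_compose[OF IH(1) t])
      have "permutation (c i)" using IH(1) permutation_permutes by blast
      then show "sign (c (Suc i)) = (-1) ^ Suc i"
        unfolding c_Suc by (simp only: sign_compose permutation_swap_id IH(2)) (simp add: sign_swap_id)
    qed
  qed (simp add: c0 permutes_id)
  have S: "{..<Suc k} = insert 0 (Suc ` {..<k})" by (auto simp: less_Suc_eq_0_disj)
  have inj: "inj_on Suc {..<k}" by simp
  let ?f = "\<lambda>p. of_int (sign p) * F (v (p 0)) (\<lambda>j. v (p (Suc j)))"
  have "alternation (Suc k) (\<lambda>w. F (w 0) (\<lambda>j. w (Suc j))) v =
    (\<Sum>b\<in>{..<Suc k}. \<Sum>q | q permutes Suc ` {..<k}. ?f (Transposition.transpose 0 b \<circ> q))"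
    unfolding alternation_def S by (rule sum_over_permutations_insert) auto
  also have "\<dots> = (\<Sum>b\<in>{..<Suc k}. \<Sum>q | q permutes Suc ` {..<k}. ?f (c b \<circ> q))"
  proof (rule sum.cong[OF refl])
    fix b assume "b \<in> {..<Suc k}"
    then have b: "b \<le> k" by simp
    \<comment> \<open>The decomposition of the permutations over \<open>insert\<close> represents
      cosets by transpositions of 0 and \<open>b\<close>. Such a transposition differs from
      \<open>c b\<close> by \<open>r\<close>, which fixes 0 and is absorbed by the sum over
      \<open>q\<close>.\<close>
    define r where "r = Transposition.transpose 0 b \<circ> c b"
    have t: "Transposition.transpose 0 b permutes {..<Suc k}"
      using b by (intro permutes_swap_id) auto
    have "r permutes {..<Suc k}" unfolding r_def using t c_perm[OF b] by (auto intro: permutes_compose)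
    moreover have "r 0 = 0" by (simp add: r_def c_def)
    ultimately have r: "r permutes Suc ` {..<k}"
      unfolding S by (metis permutes_superset insertE insert_Diff_single DiffE Diff_insert_absorb empty_iff)
    have eq: "Transposition.transpose 0 b \<circ> (r \<circ> q) = c b \<circ> q" for q
      by (simp add: r_def fun_eq_iff)
    show "(\<Sum>q | q permutes Suc ` {..<k}. ?f (Transposition.transpose 0 b \<circ> q)) =
        (\<Sum>q | q permutes Suc ` {..<k}. ?f (c b \<circ> q))"
      by (subst setum_permutations_compose_left[OF r]) (simp only: eq)
  qed
  also have "\<dots> = (\<Sum>b\<in>{..<Suc k}. \<Sum>q | q permutes {..<k}. ?f (c b \<circ> map_permutation {..<k} Suc q))"
    by (simp only: sum_permutes_image[OF inj])
  also have "\<dots> = (\<Sum>i\<le>k. (-1) ^ i * alternation k (F (v i)) (\<lambda>j. if j < i then v j else v (Suc j)))"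
    unfolding lessThan_Suc_atMost alternation_def sum_distrib_left
  proof (intro sum.cong refl)
    fix b q assume b': "b \<in> {..k}" and "q \<in> {q. q permutes {..<k}}"
    then have q: "q permutes {..<k}" and b: "b \<le> k" by auto
    let ?q = "map_permutation {..<k} Suc q"
    have qp: "?q permutes Suc ` {..<k}"
      using q by (intro map_permutation_permutes) (auto simp: bij_betw_def)
    have s: "sign (c b \<circ> ?q) = (-1) ^ b * sign q"
      using c_perm[OF b] qp q sign_compose[of "c b" ?q]
      by (simp add: permutation_permutes) (metis finite_imageI finite_lessThan inj sign_map_permutation)
    have 1: "?q 0 = 0" using qp by (auto simp: permutes_def)
    have 2: "?q (Suc j) = Suc (q j)" if "j < k" for j
      using that map_permutation_apply[OF inj] by simp
    have "F (v b) (\<lambda>j. v (c b (?q (Suc j)))) = F (v b) (\<lambda>j. if q j < b then v (q j) else v (Suc (q j)))"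
      by (rule dep) (auto simp: 2 c_def)
    moreover have "c b 0 = b" by (simp add: c_def)
    ultimately show "?f (c b \<circ> ?q) = (-1) ^ b * (of_int (sign q) *
        F (v b) (\<lambda>i. if q i < b then v (q i) else v (Suc (q i))))"
      by (simp add: s 1)
  qed
  finally show ?thesis by simp
qed

text \<open>Induction on \<open>j\<close>, the number of leading entries that may be arbitrary;
  linearity releases one more entry at each step.\<close>

lemma multilinear_eq_0:
  fixes F :: "(nat \<Rightarrow> 'a::real_vector) \<Rightarrow> real"
  assumes lin: "\<And>i w. i < k \<Longrightarrow> linear (\<lambda>x. F (w(i := x)))" and S: "span S = UNIV"
    and 0: "\<And>w. (\<And>i. i < k \<Longrightarrow> w i \<in> S) \<Longrightarrow> F w = 0"
  shows "F w = 0"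
proof -
  have "F w = 0" if "j \<le> k" "\<And>i. j \<le> i \<Longrightarrow> i < k \<Longrightarrow> w i \<in> S" for j w
    using that
  proof (induction j arbitrary: w)
    case (Suc j)
    have l: "linear (\<lambda>x. F (w(j := x)))" using lin Suc by simp
    have "F (w(j := x)) = 0" if "x \<in> S" for x
      using that Suc by (intro Suc.IH) (auto simp: le_Suc_eq Suc_le_eq)
    then have "F (w(j := w j)) = 0"
      using linear_eq_0_on_span[OF l, of S "w j"] S by simp
    then show ?case by simp
  qed (use 0 in auto)
  from this[of k w] show ?thesis by simp
qed

section \<open>Alternating sums over a symplectic basis\<close>

text \<open>
  A symplectic basis is indexed by \<open>'n \<times> bool\<close>, the indices \<open>(k, False)\<close> and \<open>(k, True)\<close>
  being partners. In the next two lemmas \<open>M + 1\<close> is the number of pairs.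
\<close>

text \<open>
  If all pairs \<open>u (2 * i + 1)\<close>, \<open>u (2 * i + 2)\<close> are partners, the sum is a multiple of the trace
  of \<open>P\<close>. Otherwise every term vanishes: if all pairs but the \<open>j\<close>-th are partners, then so is
  the \<open>j\<close>-th, by counting.
\<close>

lemma matching_sum_eq_0:
  fixes u :: "nat \<Rightarrow> 'n::finite \<times> bool" and P \<omega> :: "'n \<times> bool \<Rightarrow> 'n \<times> bool \<Rightarrow> real"
  assumes M: "CARD('n) = Suc M"
    and \<omega>0: "\<And>a b. \<omega> a b \<noteq> 0 \<Longrightarrow> b = (fst a, \<not> snd a)"
    and \<omega>1: "\<And>k. \<omega> (k, False) (k, True) = c" "\<And>k. \<omega> (k, True) (k, False) = - c"
    and P_skew: "\<And>a b. P a b = - P b a"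
    and P_sum: "(\<Sum>k\<in>UNIV. P (k, False) (k, True)) = 0"
    and P0: "P (fst (u 0), False) (fst (u 0), True) = 0"
    and inj: "inj_on u {..<2 * M + 1}"
    and missing: "(fst (u 0), \<not> snd (u 0)) \<notin> u ` {..<2 * M + 1}"
  shows "(\<Sum>j<M. P (u (2 * j + 1)) (u (2 * j + 2)) *
      (\<Prod>i\<in>{..<M} - {j}. \<omega> (u (2 * i + 1)) (u (2 * i + 2)))) = 0"
proof -
  define paired where "paired i \<longleftrightarrow> u (2 * i + 2) = (fst (u (2 * i + 1)), \<not> snd (u (2 * i + 1)))" for i
  define k where "k i = fst (u (2 * i + 1))" for i
  have fst0: "fst (u l) \<noteq> fst (u 0)" if "0 < l" "l < 2 * M + 1" for l
  proof
    assume "fst (u l) = fst (u 0)"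
    then have "u l = u 0 \<or> u l = (fst (u 0), \<not> snd (u 0))" by (auto simp: prod_eq_iff)
    moreover have "u l \<noteq> u 0" using inj that by (auto dest: inj_onD)
    ultimately show False using missing that by (metis image_eqI lessThan_iff)
  qed
  have pos: "l = 2 * i + 1 \<or> l = 2 * i + 2"
    if "paired i" "i < M" "l < 2 * M + 1" "fst (u l) = k i" for i l
  proof -
    have "u l = u (2 * i + 1) \<or> u l = u (2 * i + 2)"
      using that unfolding paired_def k_def by (auto simp: prod_eq_iff)
    then show ?thesis using inj that by (auto dest: inj_onD)
  qed
  have k_inj: "inj_on k S" if "S \<subseteq> {..<M}" "\<And>i. i \<in> S \<Longrightarrow> paired i" for S
  proof (rule inj_onI)
    fix i i' assume i: "i \<in> S" "i' \<in> S" "k i = k i'"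
    then have "2 * i + 1 = 2 * i' + 1 \<or> 2 * i + 1 = 2 * i' + 2"
      using that by (intro pos) (auto simp: k_def)
    then show "i = i'" by presburger
  qed
  have k0: "k i \<noteq> fst (u 0)" if "i < M" for i
    unfolding k_def using that by (intro fst0) auto
  show ?thesis
  proof (cases "\<forall>i<M. paired i")
    case True
    \<comment> \<open>Orientation of the \<open>i\<close>-th pair. \<open>P\<close> and
      \<open>\<omega>\<close> both change sign with it, so every summand carries the same product of
      all \<open>\<epsilon> i\<close>.\<close>
    define \<epsilon> :: "nat \<Rightarrow> real" where "\<epsilon> i = (if snd (u (2 * i + 1)) then -1 else 1)" for i
    have vals: "P (u (2 * i + 1)) (u (2 * i + 2)) = \<epsilon> i * P (k i, False) (k i, True)"
      "\<omega> (u (2 * i + 1)) (u (2 * i + 2)) = \<epsilon> i * c" if "i < M" for i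
    proof -
      have "u (2 * i + 2) = (k i, \<not> snd (u (2 * i + 1)))" "u (2 * i + 1) = (k i, snd (u (2 * i + 1)))"
        using True that unfolding paired_def k_def by auto
      then show "P (u (2 * i + 1)) (u (2 * i + 2)) = \<epsilon> i * P (k i, False) (k i, True)"
        "\<omega> (u (2 * i + 1)) (u (2 * i + 2)) = \<epsilon> i * c"
        unfolding \<epsilon>_def using \<omega>1[of "k i"] P_skew[of "(k i, True)" "(k i, False)"]
        by (cases "snd (u (2 * i + 1))"; simp)+
    qed
    have inj_k: "inj_on k {..<M}" using True by (intro k_inj) auto
    have "k ` {..<M} = UNIV - {fst (u 0)}"
      using k0 M inj_k by (intro card_subset_eq) (auto simp: card_image card_Diff_singleton)
    then have "(\<Sum>i<M. P (k i, False) (k i, True)) = (\<Sum>k\<in>UNIV - {fst (u 0)}. P (k, False) (k, True))"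
      using sum.reindex[OF inj_k, of "\<lambda>k. P (k, False) (k, True)"] by simp
    also have "\<dots> = 0" using P_sum P0 by (simp add: sum_diff1)
    finally have s: "(\<Sum>i<M. P (k i, False) (k i, True)) = 0" .
    have "P (u (2 * j + 1)) (u (2 * j + 2)) * (\<Prod>i\<in>{..<M} - {j}. \<omega> (u (2 * i + 1)) (u (2 * i + 2))) =
      (\<Prod>i<M. \<epsilon> i) * c ^ (M - 1) * P (k j, False) (k j, True)" if "j < M" for j
    proof -
      have "(\<Prod>i\<in>{..<M} - {j}. \<omega> (u (2 * i + 1)) (u (2 * i + 2))) = (\<Prod>i\<in>{..<M} - {j}. \<epsilon> i * c)"
        by (rule prod.cong) (auto simp: vals(2)[simplified])
      also have "\<dots> = (\<Prod>i\<in>{..<M} - {j}. \<epsilon> i) * c ^ (M - 1)"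
        using that by (simp add: prod.distrib)
      finally show ?thesis
        using that prod.remove[of "{..<M}" j \<epsilon>] by (simp only: vals(1)) simp
    qed
    then have "(\<Sum>j<M. P (u (2 * j + 1)) (u (2 * j + 2)) *
      (\<Prod>i\<in>{..<M} - {j}. \<omega> (u (2 * i + 1)) (u (2 * i + 2)))) =
      (\<Sum>j<M. (\<Prod>i<M. \<epsilon> i) * c ^ (M - 1) * P (k j, False) (k j, True))"
      by (intro sum.cong) auto
    also have "\<dots> = 0" using s by (simp flip: sum_distrib_left)
    finally show ?thesis .
  next
    case False
    have "(\<Prod>i\<in>{..<M} - {j}. \<omega> (u (2 * i + 1)) (u (2 * i + 2))) = 0" if j: "j < M" for j
    proof (rule ccontr)
      assume "(\<Prod>i\<in>{..<M} - {j}. \<omega> (u (2 * i + 1)) (u (2 * i + 2))) \<noteq> 0"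
      then have p: "paired i" if "i < M" "i \<noteq> j" for i
        using that \<omega>0 unfolding paired_def by (auto simp: prod_zero_iff)
      \<comment> \<open>\<open>u 0\<close> and the \<open>M - 1\<close> partner pairs use up
        \<open>M\<close> of the \<open>M + 1\<close> indices; the remaining one must belong to both
        entries of the \<open>j\<close>-th pair.\<close>
      define K where "K = insert (fst (u 0)) (k ` ({..<M} - {j}))"
      have "card K = M"
      proof -
        have "card (k ` ({..<M} - {j})) = M - 1"
          using p j by (subst card_image) (auto intro!: k_inj)
        moreover have "fst (u 0) \<notin> k ` ({..<M} - {j})" 
        proof
          assume "fst (u 0) \<in> k ` ({..<M} - {j})"
          then obtain i where "fst (u 0) = k i" "i \<in> {..<M} - {j}" by (rule imageE)
          then show False using k0[of i] by simp
        qed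
        ultimately show ?thesis unfolding K_def using j by (subst card_insert_disjoint) simp_all
      qed
      then have "card (UNIV - K) = 1" using M by (simp add: card_Diff_subset)
      then obtain x where x: "UNIV - K = {x}" by (auto simp: card_1_singleton_iff)
      have "fst (u l) \<notin> K" if l: "l = 2 * j + 1 \<or> l = 2 * j + 2" for l
      proof
        assume "fst (u l) \<in> K"
        then obtain i where i: "i < M" "i \<noteq> j" "fst (u l) = k i"
          unfolding K_def using fst0[of l] l j by auto
        then have "l = 2 * i + 1 \<or> l = 2 * i + 2" using l j p by (intro pos) auto
        then show False using l i(2) by presburger
      qed
      then have "fst (u (2 * j + 1)) = x" "fst (u (2 * j + 2)) = x" using x by blast+
      moreover have "u (2 * j + 1) \<noteq> u (2 * j + 2)"
        using inj_onD[OF inj, of "2 * j + 1" "2 * j + 2"] j by auto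
      ultimately have "paired j" unfolding paired_def by (auto simp: prod_eq_iff)
      then show False using p False by blast
    qed
    then show ?thesis by (intro sum.neutral) auto
  qed
qed

text \<open>If \<open>f\<close> is injective on the \<open>2 * M + 1\<close> slots, exactly one
  basis index \<open>m\<close> is missed. In a nonzero term the partner of \<open>m\<close> is an
  argument of \<open>\<psi>\<close>; rotating it to slot 0 replaces \<open>\<psi>\<close> by its
  cyclic sum \<open>\<Psi>\<close>. For each permutation the sum over \<open>j\<close> is then of
  the kind treated in \<open>matching_sum_eq_0\<close>.\<close>

lemma alternation_pairing_eq_0:
  fixes f :: "nat \<Rightarrow> 'n::finite \<times> bool" and \<omega> :: "'n \<times> bool \<Rightarrow> 'n \<times> bool \<Rightarrow> real"
    and \<psi> :: "'n \<times> bool \<Rightarrow> 'n \<times> bool \<Rightarrow> 'n \<times> bool \<Rightarrow> real"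
  assumes M: "CARD('n) = Suc M"
    and \<omega>0: "\<And>a b. \<omega> a b \<noteq> 0 \<Longrightarrow> b = (fst a, \<not> snd a)"
    and \<omega>1: "\<And>k. \<omega> (k, False) (k, True) = c" "\<And>k. \<omega> (k, True) (k, False) = - c"
    and \<psi>_skew: "\<And>x y z. \<psi> x y z = - \<psi> x z y"
    and \<psi>_sum: "\<And>x. (\<Sum>k\<in>UNIV. \<psi> x (k, False) (k, True) + \<psi> (k, False) (k, True) x +
                   \<psi> (k, True) x (k, False)) = 0"
  shows "(\<Sum>j<M. alternation (2 * M + 1) (\<lambda>w. \<psi> (w 0) (w (2 * j + 1)) (w (2 * j + 2)) *
      (\<Prod>i\<in>{..<M} - {j}. \<omega> (w (2 * i + 1)) (w (2 * i + 2)))) f) = 0"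
proof (cases "inj_on f {..<2 * M + 1}")
  case False
  then obtain a b where "a < 2 * M + 1" "b < 2 * M + 1" "a \<noteq> b" "f a = f b"
    unfolding inj_on_def by auto
  then show ?thesis by (intro sum.neutral ballI alternation_repeated)
next
  case True
  define \<Psi> where "\<Psi> x y z = \<psi> x y z + \<psi> y z x + \<psi> z x y" for x y z
  have "card (UNIV - f ` {..<2 * M + 1}) = CARD('n \<times> bool) - (2 * M + 1)"
    using card_image[OF True] by (subst card_Diff_subset) (simp_all only: card_lessThan finite subset_UNIV finite_imageI finite_lessThan)
  then have "card (UNIV - f ` {..<2 * M + 1}) = 1"
    using M by simp
  then obtain m where m: "UNIV - f ` {..<2 * M + 1} = {m}" by (auto simp: card_1_singleton_iff)
  have "(fst m, \<not> snd m) \<notin> {m}" by (simp add: prod_eq_iff)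
  then have "(fst m, \<not> snd m) \<in> f ` {..<2 * M + 1}" using m by blast
  then obtain a where a: "a < 2 * M + 1" "f a = (fst m, \<not> snd m)" by auto
  define W where "W j w = (\<Prod>i\<in>{..<M} - {j}. \<omega> (w (2 * i + 1)) (w (2 * i + 2)))" for j w
  have alt: "alternation (2 * M + 1) (\<lambda>w. \<psi> (w 0) (w (2 * j + 1)) (w (2 * j + 2)) * W j w) f =
    (\<Sum>p | p permutes {..<2 * M + 1}. of_int (sign p) *
      (if p 0 = a then \<Psi> (f (p 0)) (f (p (2 * j + 1))) (f (p (2 * j + 2))) * W j (\<lambda>i. f (p i)) else 0))"
    (is "?L = ?R") if j: "j < M" for j
  proof -
    let ?b = "2 * j + 1" and ?c = "2 * j + 2"
    define G where "G p = \<psi> (f (p 0)) (f (p ?b)) (f (p ?c)) * W j (\<lambda>i. f (p i))" for p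
    define I where "I l = (\<Sum>p | p permutes {..<2 * M + 1}. of_int (sign p) * (if p l = a then G p else 0))" for l
    \<comment> \<open>A three-cycle on the slots of \<open>\<psi>\<close>: it is even and leaves the
      \<open>\<omega>\<close> factors alone.\<close>
    define q where "q = Transposition.transpose 0 ?b \<circ> Transposition.transpose ?b ?c"
    have q_vals: "q 0 = ?b" "q ?b = ?c" "q ?c = 0" "l \<notin> {0, ?b, ?c} \<Longrightarrow> q l = l" for l
      by (auto simp: q_def Transposition.transpose_def)
    have t: "Transposition.transpose 0 ?b permutes {..<2 * M + 1}"
        "Transposition.transpose ?b ?c permutes {..<2 * M + 1}"
      using j by (auto intro!: permutes_swap_id)
    have q: "q permutes {..<2 * M + 1}" "sign q = 1"
      unfolding q_def using t
      by (auto intro: permutes_compose simp: sign_compose permutation_swap_id sign_swap_id)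
    have W_q: "W j (\<lambda>i. w (q i)) = W j w" for w :: "nat \<Rightarrow> 'n \<times> bool"
      unfolding W_def
    proof (rule prod.cong[OF refl])
      fix i assume "i \<in> {..<M} - {j}"
      then have "i \<noteq> j" by simp
      then have n: "2 * i + 1 \<notin> {0, ?b, ?c}" "2 * i + 2 \<notin> {0, ?b, ?c}"
        unfolding insert_iff empty_iff by presburger+
      show "\<omega> (w (q (2 * i + 1))) (w (q (2 * i + 2))) = \<omega> (w (2 * i + 1)) (w (2 * i + 2))"
        by (simp only: q_vals(4)[OF n(1)] q_vals(4)[OF n(2)])
    qed
    have rot: "(\<Sum>p | p permutes {..<2 * M + 1}. of_int (sign p) * h (p \<circ> q)) =
        (\<Sum>p | p permutes {..<2 * M + 1}. of_int (sign p) * h p)" for h :: "_ \<Rightarrow> real"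
      using sum_sign_compose_right[OF q(1)] q(2) by simp
    have "G p = (if p 0 = a then G p else 0) + (if p ?b = a then G p else 0) + (if p ?c = a then G p else 0)"
      if p: "p permutes {..<2 * M + 1}" for p
    proof -
      have inj: "p x = p y \<longleftrightarrow> x = y" for x y using permutes_inj[OF p] by (auto dest: injD)
      have "p 0 = a \<or> p ?b = a \<or> p ?c = a" if "G p \<noteq> 0"
      proof -
        obtain l where l: "l < 2 * M + 1" "p l = a"
          using a(1) p by (metis permutes_in_image permutes_inverses(1) lessThan_iff permutes_inv)
        have nm: "f (p x) \<noteq> m" if "x < 2 * M + 1" for x
          using that m p by (metis DiffD2 imageI insertI1 lessThan_iff permutes_in_image)
        have "l = 0 \<or> l = ?b \<or> l = ?c"
        proof (rule ccontr)
          \<comment> \<open>Otherwise \<open>a\<close> would sit in the \<open>i\<close>-th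
            \<open>\<omega>\<close> factor, with slots \<open>2 * i + 1\<close> and
            \<open>2 * i + 2\<close>; this factor being nonzero, the missing \<open>m\<close> would
            be a value of \<open>f\<close>.\<close>
          assume n: "\<not> ?thesis"
          define i where "i = (l - 1) div 2"
          have i: "i < M" "i \<noteq> j" "l = 2 * i + 1 \<or> l = 2 * i + 2"
            using n l(1) unfolding i_def by presburger+
          then have "\<omega> (f (p (2 * i + 1))) (f (p (2 * i + 2))) \<noteq> 0"
            using that unfolding G_def W_def by (auto simp: prod_zero_iff)
          then have "f (p (2 * i + 2)) = (fst (f (p (2 * i + 1))), \<not> snd (f (p (2 * i + 1))))"
            by (rule \<omega>0)
          then show False
            using i l(2) a(2) nm[of "2 * i + 1"] nm[of "2 * i + 2"] by (auto simp: prod_eq_iff)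
        qed
        then show ?thesis using l by blast
      qed
      then show ?thesis by (auto simp: inj)
    qed
    then have "?L = I 0 + I ?b + I ?c"
      unfolding I_def alternation_def G_def[symmetric]
      by (simp only: sum.distrib[symmetric] distrib_left[symmetric]) (intro sum.cong refl, simp)
    \<comment> \<open>One turn of the three-cycle moves the condition on slot \<open>?c\<close> to
      slot 0; slot \<open>?b\<close> takes two turns.\<close>
    also have "I ?c = (\<Sum>p | p permutes {..<2 * M + 1}. of_int (sign p) *
        (if p 0 = a then \<psi> (f (p ?b)) (f (p ?c)) (f (p 0)) * W j (\<lambda>i. f (p i)) else 0))"
      unfolding I_def G_def by (subst rot[symmetric]) (simp only: o_apply q_vals W_q[of "\<lambda>i. f (_ i)"])
    also have "I ?b = (\<Sum>p | p permutes {..<2 * M + 1}. of_int (sign p) *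
        (if p 0 = a then \<psi> (f (p ?c)) (f (p 0)) (f (p ?b)) * W j (\<lambda>i. f (p i)) else 0))"
      unfolding I_def G_def
      by (subst rot[symmetric], subst rot[symmetric]) (simp only: o_apply q_vals W_q[of "\<lambda>i. f (_ i)"] W_q[of "\<lambda>i. f (_ (q i))"])
    also have "I 0 + (\<Sum>p | p permutes {..<2 * M + 1}. of_int (sign p) *
        (if p 0 = a then \<psi> (f (p ?c)) (f (p 0)) (f (p ?b)) * W j (\<lambda>i. f (p i)) else 0)) +
       (\<Sum>p | p permutes {..<2 * M + 1}. of_int (sign p) *
        (if p 0 = a then \<psi> (f (p ?b)) (f (p ?c)) (f (p 0)) * W j (\<lambda>i. f (p i)) else 0)) = ?R"
      unfolding I_def G_def sum.distrib[symmetric] \<Psi>_def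
      by (intro sum.cong refl) (simp add: algebra_simps)
    finally show ?thesis .
  qed
  have "(\<Sum>j<M. alternation (2 * M + 1) (\<lambda>w. \<psi> (w 0) (w (2 * j + 1)) (w (2 * j + 2)) * W j w) f) =
    (\<Sum>j<M. \<Sum>p | p permutes {..<2 * M + 1}. of_int (sign p) *
      (if p 0 = a then \<Psi> (f (p 0)) (f (p (2 * j + 1))) (f (p (2 * j + 2))) * W j (\<lambda>i. f (p i)) else 0))"
    by (rule sum.cong[OF refl], rule alt) simp
  also have "\<dots> = (\<Sum>p | p permutes {..<2 * M + 1}. of_int (sign p) * (if p 0 = a then
      (\<Sum>j<M. \<Psi> (f (p 0)) (f (p (2 * j + 1))) (f (p (2 * j + 2))) * W j (\<lambda>i. f (p i))) else 0))"
    by (subst sum.swap) (auto intro!: sum.cong simp: sum_distrib_left)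
  also have "\<dots> = 0"
  proof (rule sum.neutral, rule ballI)
    fix p assume "p \<in> {p. p permutes {..<2 * M + 1}}"
    then have p: "p permutes {..<2 * M + 1}" by simp
    have "(\<Sum>j<M. \<Psi> (f (p 0)) (f (p (2 * j + 1))) (f (p (2 * j + 2))) * W j (\<lambda>i. f (p i))) = 0"
      if "p 0 = a"
      unfolding W_def
    proof (rule matching_sum_eq_0[OF M \<omega>0 \<omega>1])
      show "\<Psi> (f (p 0)) x y = - \<Psi> (f (p 0)) y x" for x y
        unfolding \<Psi>_def using \<psi>_skew[of "f (p 0)" x y] \<psi>_skew[of x y "f (p 0)"] \<psi>_skew[of y "f (p 0)" x]
        by linarith
      show "(\<Sum>k\<in>UNIV. \<Psi> (f (p 0)) (k, False) (k, True)) = 0"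
        unfolding \<Psi>_def by (rule \<psi>_sum)
      have z: "\<Psi> x x y = 0" "\<Psi> x y x = 0" for x y
        unfolding \<Psi>_def using \<psi>_skew[of x x y] \<psi>_skew[of y x x] \<psi>_skew[of x y x] by linarith+
      show "\<Psi> (f (p 0)) (fst (f (p 0)), False) (fst (f (p 0)), True) = 0"
        using z by (cases "f (p 0)"; cases "snd (f (p 0))") auto
      have "inj_on (f \<circ> p) {..<2 * M + 1}"
        using True p by (intro comp_inj_on) (auto simp: permutes_inj_on permutes_image)
      then show "inj_on (\<lambda>i. f (p i)) {..<2 * M + 1}" by (simp add: o_def)
      have "(\<lambda>i. f (p i)) ` {..<2 * M + 1} = f ` {..<2 * M + 1}"
        using p by (metis image_image permutes_image)
      then show "(fst (f (p 0)), \<not> snd (f (p 0))) \<notin> (\<lambda>i. f (p i)) ` {..<2 * M + 1}"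
        using m a(2) that by auto
    qed
    then show "of_int (sign p) * (if p 0 = a then
      (\<Sum>j<M. \<Psi> (f (p 0)) (f (p (2 * j + 1))) (f (p (2 * j + 2))) * W j (\<lambda>i. f (p i))) else 0) = (0::real)"
      by simp
  qed
  finally show ?thesis by (simp add: W_def)
qed

lemma linear_alternation:
  fixes F :: "'a::real_vector form"
  assumes lin: "\<And>i w. i < k \<Longrightarrow> linear (\<lambda>x. F (w(i := x)))" and i: "i < k"
  shows "linear (\<lambda>x. alternation k F (w(i := x)))"
  unfolding alternation_def
proof (intro linear_compose_sum ballI)
  fix p assume "p \<in> {p. p permutes {..<k}}"
  then have p: "p permutes {..<k}" by simp
  have "(\<lambda>j. (w(i := x)) (p j)) = (\<lambda>j. w (p j))(inv p i := x)" for x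
    using permutes_inverses[OF p] by (auto simp: fun_eq_iff)
  moreover have "inv p i < k"
    using permutes_in_image[OF permutes_inv[OF p]] i by auto
  ultimately have "linear (\<lambda>x. F (\<lambda>j. (w(i := x)) (p j)))" using lin by simp
  from linear_compose_scale_right[OF this, of "of_int (sign p)"]
  show "linear (\<lambda>x. of_int (sign p) * F (\<lambda>j. (w(i := x)) (p j)))" by simp
qed

lemma linear_mult_const: "linear f \<Longrightarrow> linear (\<lambda>x. f x * c)" for c :: real
  by (auto intro!: linearI simp: linear_add linear_scale algebra_simps)

text \<open>Every slot below \<open>2 * M + 1\<close> occurs once, either in \<open>\<psi>\<close>
  or in a single \<open>\<omega>\<close> factor.\<close>

lemma linear_pairing_slot:
  fixes \<psi> :: "'a::real_vector \<Rightarrow> 'a \<Rightarrow> 'a \<Rightarrow> real" and F :: "'a form" and j M l :: nat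
  assumes \<psi>: "\<And>y z. linear (\<lambda>x. \<psi> x y z)" "\<And>x z. linear (\<lambda>y. \<psi> x y z)" "\<And>x y. linear (\<lambda>z. \<psi> x y z)"
    and \<omega>: "\<And>y. linear (\<lambda>x. \<omega> x y)" "\<And>x. linear (\<lambda>y. \<omega> x y)"
    and F: "\<And>w. F w = \<psi> (w 0) (w (2 * j + 1)) (w (2 * j + 2)) *
      (\<Prod>i\<in>{..<M} - {j}. \<omega> (w (2 * i + 1)) (w (2 * i + 2)))"
    and l: "l < 2 * M + 1"
  shows "linear (\<lambda>x. F (w(l := x)))"
proof (cases "l \<in> {0, 2 * j + 1, 2 * j + 2}")
  case True
  have rest: "(\<Prod>i\<in>{..<M} - {j}. \<omega> ((w(l := x)) (2 * i + 1)) ((w(l := x)) (2 * i + 2))) =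
      (\<Prod>i\<in>{..<M} - {j}. \<omega> (w (2 * i + 1)) (w (2 * i + 2)))" for x
  proof (rule prod.cong[OF refl])
    fix i assume "i \<in> {..<M} - {j}"
    then have "i \<noteq> j" by simp
    then have "2 * i + 1 \<noteq> l" "2 * i + 2 \<noteq> l"
      using True unfolding insert_iff empty_iff by presburger+
    then show "\<omega> ((w(l := x)) (2 * i + 1)) ((w(l := x)) (2 * i + 2)) = \<omega> (w (2 * i + 1)) (w (2 * i + 2))"
      by simp
  qed
  have "linear (\<lambda>x. \<psi> ((w(l := x)) 0) ((w(l := x)) (2 * j + 1)) ((w(l := x)) (2 * j + 2)))"
    using True \<psi> by auto
  then show ?thesis
    unfolding F rest by (rule linear_mult_const)
next
  case False
  define i where "i = (l - 1) div 2"
  have i: "i < M" "i \<noteq> j" "l = 2 * i + 1 \<or> l = 2 * i + 2"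
    using False l unfolding i_def insert_iff empty_iff by presburger+
  have 1: "(w(l := x)) 0 = w 0" "(w(l := x)) (2 * j + 1) = w (2 * j + 1)" "(w(l := x)) (2 * j + 2) = w (2 * j + 2)" for x
    using False by auto
  have 2: "(\<Prod>i\<in>{..<M} - {j}. \<omega> ((w(l := x)) (2 * i + 1)) ((w(l := x)) (2 * i + 2))) =
     \<omega> ((w(l := x)) (2 * i + 1)) ((w(l := x)) (2 * i + 2)) *
      (\<Prod>i\<in>{..<M} - {j} - {i}. \<omega> (w (2 * i + 1)) (w (2 * i + 2)))" for x
  proof -
    have "(\<Prod>i\<in>{..<M} - {j} - {i}. \<omega> ((w(l := x)) (2 * i + 1)) ((w(l := x)) (2 * i + 2))) =
       (\<Prod>i\<in>{..<M} - {j} - {i}. \<omega> (w (2 * i + 1)) (w (2 * i + 2)))"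
    proof (rule prod.cong[OF refl])
      fix i' assume "i' \<in> {..<M} - {j} - {i}"
      then have "i' \<noteq> i" by simp
      then have "2 * i' + 1 \<noteq> l" "2 * i' + 2 \<noteq> l" using i(3) by presburger+
      then show "\<omega> ((w(l := x)) (2 * i' + 1)) ((w(l := x)) (2 * i' + 2)) = \<omega> (w (2 * i' + 1)) (w (2 * i' + 2))"
        by simp
    qed
    then show ?thesis using i by (subst prod.remove[of _ i]) auto
  qed
  have "linear (\<lambda>x. \<omega> ((w(l := x)) (2 * i + 1)) ((w(l := x)) (2 * i + 2)))"
    using i(3) \<omega> by auto
  from linear_mult_const[OF this, of "\<psi> (w 0) (w (2 * j + 1)) (w (2 * j + 2)) *
      (\<Prod>i\<in>{..<M} - {j} - {i}. \<omega> (w (2 * i + 1)) (w (2 * i + 2)))"]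
  show ?thesis
    unfolding F 1 2 by (simp only: mult_ac)
qed

context hermitian_form
begin

text \<open>A symplectic basis for the Kaehler form: \<open>(k, True)\<close> stands for
  \<open>J (e k)\<close>, the partner of \<open>e k\<close>.\<close>

definition real_basis :: "('n \<Rightarrow> complex^'n) \<Rightarrow> 'n \<times> bool \<Rightarrow> complex^'n" where
  "real_basis e x = (if snd x then J (e (fst x)) else e (fst x))"

lemma span_real_basis:
  assumes "orthonormal e UNIV"
  shows "span (range (real_basis e)) = UNIV"
proof -
  have "e k \<in> range (real_basis e)" "J (e k) \<in> range (real_basis e)" for k
    using rangeI[of "real_basis e" "(k, False)"] rangeI[of "real_basis e" "(k, True)"]
    by (simp_all add: real_basis_def)
  then have "(\<Sum>i\<in>UNIV. h v (e i) *s e i) \<in> span (range (real_basis e))" for v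
    unfolding vector_smult_eq[of "h v (e i)" "e i" for i]
    by (intro span_sum span_add span_scale span_base)
  then show ?thesis unfolding orthonormal_expansion[OF assms] by blast
qed

lemma g_orthonormal:
  assumes "orthonormal e UNIV"
  shows "g (e i) (e j) = (if i = j then 2 else 0)" "g (e i) (J (e j)) = 0"
proof -
  have "h (e i) (e j) = (if i = j then 1 else 0)" using assms by (simp add: orthonormal_def)
  then show "g (e i) (e j) = (if i = j then 2 else 0)" "g (e i) (J (e j)) = 0"
    unfolding h_def by (auto simp: complex_eq_iff split: if_splits)
qed

text \<open>Both factors are multilinear, so it suffices to take arguments from
  \<open>real_basis e\<close>, where the alternating sum depends only on their indices.\<close>

lemma alternation_kaehler_eq_0:
  assumes e: "orthonormal e UNIV" and M: "CARD('n) = Suc M"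
    and \<psi>: "\<And>y z. linear (\<lambda>x. \<psi> x y z)" "\<And>x z. linear (\<lambda>y. \<psi> x y z)" "\<And>x y. linear (\<lambda>z. \<psi> x y z)"
    and \<psi>_skew: "\<And>x y z. \<psi> x y z = - \<psi> x z y"
    and \<psi>_sum: "\<And>x. (\<Sum>k\<in>UNIV. \<psi> x (e k) (J (e k)) + \<psi> (e k) (J (e k)) x + \<psi> (J (e k)) x (e k)) = 0"
  shows "(\<Sum>j<M. alternation (2 * M + 1) (\<lambda>w. \<psi> (w 0) (w (2 * j + 1)) (w (2 * j + 2)) *
      (\<Prod>i\<in>{..<M} - {j}. g (J (w (2 * i + 1))) (w (2 * i + 2)))) v) = 0"
proof (rule multilinear_eq_0[where k = "2 * M + 1" and S = "range (real_basis e)"])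
  fix l w assume l: "l < 2 * M + 1"
  show "linear (\<lambda>x. \<Sum>j<M. alternation (2 * M + 1) (\<lambda>w. \<psi> (w 0) (w (2 * j + 1)) (w (2 * j + 2)) *
      (\<Prod>i\<in>{..<M} - {j}. g (J (w (2 * i + 1))) (w (2 * i + 2)))) (w(l := x)))"
    by (intro linear_compose_sum ballI linear_alternation l
        linear_pairing_slot[where \<psi> = \<psi> and M = M and \<omega> = "\<lambda>u v. g (J u) v"] \<psi>)
      (auto intro!: linearI)
next
  fix w assume w: "\<And>i. i < 2 * M + 1 \<Longrightarrow> w i \<in> range (real_basis e)"
  define f where "f i = (SOME x. w i = real_basis e x)" for i
  have f: "w i = real_basis e (f i)" if "i < 2 * M + 1" for i
    unfolding f_def using w[OF that] by (metis (mono_tags, lifting) imageE someI_ex)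
  have "alternation (2 * M + 1) (\<lambda>w. \<psi> (w 0) (w (2 * j + 1)) (w (2 * j + 2)) *
      (\<Prod>i\<in>{..<M} - {j}. g (J (w (2 * i + 1))) (w (2 * i + 2)))) w =
    alternation (2 * M + 1) (\<lambda>w. \<psi> (real_basis e (w 0)) (real_basis e (w (2 * j + 1))) (real_basis e (w (2 * j + 2))) *
      (\<Prod>i\<in>{..<M} - {j}. g (J (real_basis e (w (2 * i + 1)))) (real_basis e (w (2 * i + 2))))) f"
    if j: "j < M" for j
    unfolding alternation_def
  proof (intro sum.cong[OF refl] arg_cong2[of _ _ _ _ "(*)"] refl)
    fix p assume "p \<in> {p. p permutes {..<2 * M + 1}}"
    then have p: "w (p i) = real_basis e (f (p i))" if "i < 2 * M + 1" for i
      using f that permutes_in_image by fastforce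
    show "\<psi> (w (p 0)) (w (p (2 * j + 1))) (w (p (2 * j + 2))) =
      \<psi> (real_basis e (f (p 0))) (real_basis e (f (p (2 * j + 1)))) (real_basis e (f (p (2 * j + 2))))"
      using j by (simp only: p)
    show "(\<Prod>i\<in>{..<M} - {j}. g (J (w (p (2 * i + 1)))) (w (p (2 * i + 2)))) =
      (\<Prod>i\<in>{..<M} - {j}. g (J (real_basis e (f (p (2 * i + 1))))) (real_basis e (f (p (2 * i + 2)))))"
      by (rule prod.cong) (auto simp: p[simplified])
  qed
  moreover have "(\<Sum>j<M. alternation (2 * M + 1) (\<lambda>w. \<psi> (real_basis e (w 0)) (real_basis e (w (2 * j + 1))) (real_basis e (w (2 * j + 2))) *
      (\<Prod>i\<in>{..<M} - {j}. g (J (real_basis e (w (2 * i + 1)))) (real_basis e (w (2 * i + 2))))) f) = 0"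
  \<comment> \<open>\<open>c = 2\<close> is the squared \<open>g\<close>-length of a vector of unit
    length for \<open>h\<close>.\<close>
  proof (rule alternation_pairing_eq_0[OF M, where c = 2 and
        \<psi> = "\<lambda>x y z. \<psi> (real_basis e x) (real_basis e y) (real_basis e z)" and
        \<omega> = "\<lambda>x y. g (J (real_basis e x)) (real_basis e y)"])
    fix a b :: "'n \<times> bool"
    assume "g (J (real_basis e a)) (real_basis e b) \<noteq> 0"
    then show "b = (fst a, \<not> snd a)"
      by (auto simp: real_basis_def g_J_left g_orthonormal[OF e] prod_eq_iff split: if_splits)
  qed (auto simp: real_basis_def g_J_left g_orthonormal[OF e] intro: \<psi>_skew \<psi>_sum[simplified])
  ultimately show "(\<Sum>j<M. alternation (2 * M + 1) (\<lambda>w. \<psi> (w 0) (w (2 * j + 1)) (w (2 * j + 2)) *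
      (\<Prod>i\<in>{..<M} - {j}. g (J (w (2 * i + 1))) (w (2 * i + 2)))) w) = 0"
    by simp
qed (rule span_real_basis[OF e])

end

section \<open>Second derivatives\<close>

lemma frechet_derivative_cong_open:
  assumes "open S" "x \<in> S" "\<And>y. y \<in> S \<Longrightarrow> f y = f' y"
  shows "frechet_derivative f (at x) = frechet_derivative f' (at x)"
proof -
  have "(f has_derivative D) (at x) \<longleftrightarrow> (f' has_derivative D) (at x)" for D
    using has_derivative_transform_within_open[OF _ assms(1,2)] assms(3) by (metis (no_types, lifting))
  then show ?thesis unfolding frechet_derivative_def by presburger
qed

lemma differentiable_cong_open:
  assumes "open S" "x \<in> S" "\<And>y. y \<in> S \<Longrightarrow> f y = f' y" "f differentiable (at x)"
  shows "f' differentiable (at x)"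
  using assms has_derivative_transform_within_open unfolding differentiable_def by metis

lemma frechet_derivative_works': "f differentiable (at x) \<Longrightarrow>
    (f has_derivative (\<lambda>u. frechet_derivative f (at x) u)) (at x)"
  using frechet_derivative_works by force

lemma frechet_derivative_plus:
  assumes "f differentiable (at x)" "f' differentiable (at x)"
  shows "frechet_derivative (\<lambda>y. f y + f' y) (at x) u =
    frechet_derivative f (at x) u + frechet_derivative f' (at x) u"
  by (simp add: frechet_derivative_at[OF has_derivative_add[OF
        frechet_derivative_works'[OF assms(1)] frechet_derivative_works'[OF assms(2)]], symmetric])

lemma frechet_derivative_minus:
  assumes "f differentiable (at x)" "f' differentiable (at x)"
  shows "frechet_derivative (\<lambda>y. f y - f' y) (at x) u =
    frechet_derivative f (at x) u - frechet_derivative f' (at x) u"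
  by (simp add: frechet_derivative_at[OF has_derivative_diff[OF
        frechet_derivative_works'[OF assms(1)] frechet_derivative_works'[OF assms(2)]], symmetric])

lemma Ck_on_cong:
  assumes "open S" "\<And>y. y \<in> S \<Longrightarrow> f y = f' y" "Ck_on k f S"
  shows "Ck_on k f' S"
  using assms(2,3)
proof (induction k arbitrary: f f')
  case 0
  then show ?case by (simp cong: continuous_on_cong)
next
  case (Suc k)
  have "f' differentiable (at x)" if "x \<in> S" for x
    using differentiable_cong_open[OF assms(1) that Suc.prems(1)] Suc.prems(2) that by auto
  moreover have "Ck_on k (\<lambda>x. frechet_derivative f' (at x) v) S" for v
  proof (rule Suc.IH)
    show "frechet_derivative f (at y) v = frechet_derivative f' (at y) v" if "y \<in> S" for y
      using frechet_derivative_cong_open[OF assms(1) that Suc.prems(1)] by simp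
  qed (use Suc.prems in simp)
  ultimately show ?case by simp
qed

lemma Ck_on_diff:
  assumes "open S" "Ck_on k f S" "Ck_on k f' S"
  shows "Ck_on k (\<lambda>x. f x - f' x) S"
  using assms(2,3)
proof (induction k arbitrary: f f')
  case 0
  then show ?case by (simp add: continuous_on_diff)
next
  case (Suc k)
  have d: "f differentiable (at x)" "f' differentiable (at x)" if "x \<in> S" for x
    using Suc.prems that by auto
  have "Ck_on k (\<lambda>x. frechet_derivative (\<lambda>x. f x - f' x) (at x) v) S" for v
  proof (rule Ck_on_cong[OF assms(1)])
    show "Ck_on k (\<lambda>x. frechet_derivative f (at x) v - frechet_derivative f' (at x) v) S"
      using Suc by auto
    show "frechet_derivative f (at y) v - frechet_derivative f' (at y) v =
        frechet_derivative (\<lambda>x. f x - f' x) (at y) v" if "y \<in> S" for y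
      using d[OF that] by (simp add: frechet_derivative_minus)
  qed
  then show ?case using d by auto
qed

section \<open>Symmetry of mixed second derivatives\<close>

lemma mean_value_line:
  fixes f :: "'a::real_normed_vector \<Rightarrow> real"
  assumes "0 < t" "\<And>s. 0 \<le> s \<Longrightarrow> s \<le> t \<Longrightarrow> f differentiable (at (x + s *\<^sub>R u))"
  shows "\<exists>s. 0 < s \<and> s < t \<and> f (x + t *\<^sub>R u) - f x = t * frechet_derivative f (at (x + s *\<^sub>R u)) u"
proof -
  have d: "((\<lambda>s. f (x + s *\<^sub>R u)) has_real_derivative frechet_derivative f (at (x + s *\<^sub>R u)) u) (at s)"
    if "0 \<le> s" "s \<le> t" for s
  proof -
    have f: "(f has_derivative (\<lambda>v. frechet_derivative f (at (x + s *\<^sub>R u)) v)) (at (x + s *\<^sub>R u))"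
      using assms(2)[OF that] by (rule frechet_derivative_works')
    have "((\<lambda>s. x + s *\<^sub>R u) has_derivative (\<lambda>r. r *\<^sub>R u)) (at s)"
      by (auto intro!: derivative_eq_intros)
    from has_derivative_compose[OF this f]
    have "((\<lambda>s. f (x + s *\<^sub>R u)) has_derivative (\<lambda>r. frechet_derivative f (at (x + s *\<^sub>R u)) (r *\<^sub>R u))) (at s)" .
    moreover have "frechet_derivative f (at (x + s *\<^sub>R u)) (r *\<^sub>R u) =
        frechet_derivative f (at (x + s *\<^sub>R u)) u * r" for r
      using linear_scale[OF has_derivative_linear[OF f]] by simp
    ultimately show ?thesis by (simp add: has_field_derivative_def)
  qed
  from MVT2[OF assms(1), of "\<lambda>s. f (x + s *\<^sub>R u)", OF d] show ?thesis by auto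
qed

text \<open>The mean value theorem twice: along \<open>u\<close> for the difference
  \<open>k\<close>, then along \<open>v\<close> for the \<open>u\<close>-derivative of
  \<open>f\<close>.\<close>

lemma second_difference:
  fixes f :: "'a::real_normed_vector \<Rightarrow> real"
  assumes t: "0 < t"
    and d: "\<And>y. dist y x \<le> t * (norm u + norm v) \<Longrightarrow> f differentiable (at y)"
      "\<And>y. dist y x \<le> t * (norm u + norm v) \<Longrightarrow> (\<lambda>y. frechet_derivative f (at y) u) differentiable (at y)"
  shows "\<exists>y. dist y x \<le> t * (norm u + norm v) \<and>
    f (x + t *\<^sub>R u + t *\<^sub>R v) - f (x + t *\<^sub>R u) - f (x + t *\<^sub>R v) + f x =
      t * t * frechet_derivative (\<lambda>y. frechet_derivative f (at y) u) (at y) v"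
proof -
  have near: "dist (x + s *\<^sub>R u + r *\<^sub>R v) x \<le> t * (norm u + norm v)"
    if "0 \<le> s" "s \<le> t" "0 \<le> r" "r \<le> t" for s r
  proof -
    have "norm (s *\<^sub>R u + r *\<^sub>R v) \<le> s * norm u + r * norm v"
      using norm_triangle_ineq[of "s *\<^sub>R u" "r *\<^sub>R v"] that by simp
    also have "\<dots> \<le> t * norm u + t * norm v"
      using that by (intro add_mono mult_right_mono) auto
    finally show ?thesis by (simp add: dist_norm add.assoc distrib_left)
  qed
  define k where "k y = f (y + t *\<^sub>R v) - f y" for y
  have k: "(k has_derivative (\<lambda>w. frechet_derivative f (at (x + s *\<^sub>R u + t *\<^sub>R v)) w -
      frechet_derivative f (at (x + s *\<^sub>R u)) w)) (at (x + s *\<^sub>R u))" if "0 \<le> s" "s \<le> t" for s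
  proof -
    have 1: "(f has_derivative (\<lambda>w. frechet_derivative f (at (x + s *\<^sub>R u)) w)) (at (x + s *\<^sub>R u))"
      using near[OF that, of 0] t by (intro frechet_derivative_works' d) auto
    have 2: "(f has_derivative (\<lambda>w. frechet_derivative f (at (x + s *\<^sub>R u + t *\<^sub>R v)) w)) (at (x + s *\<^sub>R u + t *\<^sub>R v))"
      using near[OF that, of t] t by (intro frechet_derivative_works' d) auto
    have "((\<lambda>y. y + t *\<^sub>R v) has_derivative (\<lambda>w. w)) (at (x + s *\<^sub>R u))"
      by (auto intro!: derivative_eq_intros)
    from has_derivative_diff[OF has_derivative_compose[OF this 2] 1] show ?thesis
      unfolding k_def .
  qed
  have "\<exists>s. 0 < s \<and> s < t \<and> k (x + t *\<^sub>R u) - k x = t * frechet_derivative k (at (x + s *\<^sub>R u)) u"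
    using k by (intro mean_value_line t) (auto simp: differentiable_def)
  then obtain s where s: "0 < s" "s < t"
    "k (x + t *\<^sub>R u) - k x = t * frechet_derivative k (at (x + s *\<^sub>R u)) u" by blast
  have "frechet_derivative k (at (x + s *\<^sub>R u)) u =
     frechet_derivative f (at (x + s *\<^sub>R u + t *\<^sub>R v)) u - frechet_derivative f (at (x + s *\<^sub>R u)) u"
    using frechet_derivative_at[OF k[of s]] s by (simp add: fun_eq_iff)
  moreover have "\<exists>r. 0 < r \<and> r < t \<and>
      frechet_derivative f (at (x + s *\<^sub>R u + t *\<^sub>R v)) u - frechet_derivative f (at (x + s *\<^sub>R u)) u =
      t * frechet_derivative (\<lambda>y. frechet_derivative f (at y) u) (at (x + s *\<^sub>R u + r *\<^sub>R v)) v"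
    using near s by (intro mean_value_line t d(2)) auto
  then obtain r where r: "0 < r" "r < t"
      "frechet_derivative f (at (x + s *\<^sub>R u + t *\<^sub>R v)) u - frechet_derivative f (at (x + s *\<^sub>R u)) u =
      t * frechet_derivative (\<lambda>y. frechet_derivative f (at y) u) (at (x + s *\<^sub>R u + r *\<^sub>R v)) v" by blast
  ultimately have "k (x + t *\<^sub>R u) - k x =
      t * (t * frechet_derivative (\<lambda>y. frechet_derivative f (at y) u) (at (x + s *\<^sub>R u + r *\<^sub>R v)) v)"
    using s(3) by simp
  then show ?thesis
    using near[of s r] s r by (intro exI[of _ "x + s *\<^sub>R u + r *\<^sub>R v"]) (auto simp: k_def algebra_simps)
qed

text \<open>The second difference is symmetric in \<open>u\<close> and \<open>v\<close>. At every
  small scale it therefore yields a value of \<open>?A\<close> and a value of \<open>?B\<close>, at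
  two points near \<open>x\<close>, that agree; continuity at \<open>x\<close> concludes.\<close>

lemma second_derivative_commute_real:
  fixes f :: "'a::real_normed_vector \<Rightarrow> real"
  assumes S: "open S" "x \<in> S" and f: "Ck_on (Suc (Suc 0)) f S"
  shows "frechet_derivative (\<lambda>y. frechet_derivative f (at y) u) (at x) v =
    frechet_derivative (\<lambda>y. frechet_derivative f (at y) v) (at x) u"
    (is "?A x = ?B x")
proof -
  have "\<bar>?A x - ?B x\<bar> < \<epsilon>" if "\<epsilon> > 0" for \<epsilon>
  proof -
    have "continuous_on S ?A" "continuous_on S ?B" using f by auto
    then have c: "isCont ?A x" "isCont ?B x" using S by (simp_all add: continuous_on_eq_continuous_at)
    have e: "\<epsilon> / 2 > 0" using that by simp
    obtain d1 where d1: "d1 > 0" "\<And>y. dist y x < d1 \<Longrightarrow> \<bar>?A y - ?A x\<bar> < \<epsilon> / 2"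
      using c(1)[unfolded continuous_at_eps_delta, rule_format, OF e] unfolding dist_real_def by blast
    obtain d2 where d2: "d2 > 0" "\<And>y. dist y x < d2 \<Longrightarrow> \<bar>?B y - ?B x\<bar> < \<epsilon> / 2"
      using c(2)[unfolded continuous_at_eps_delta, rule_format, OF e] unfolding dist_real_def by blast
    obtain d3 where d3: "d3 > 0" "\<And>y. dist y x < d3 \<Longrightarrow> y \<in> S"
      using S open_dist by blast
    \<comment> \<open>Small enough to stay within all three radii; the \<open>+ 1\<close> keeps the
      denominator positive when \<open>u = v = 0\<close>.\<close>
    define t where "t = min d1 (min d2 d3) / (norm u + norm v + 1)"
    have n: "norm u + norm v + 1 > 0" using norm_ge_zero[of u] norm_ge_zero[of v] by linarith
    have t: "t > 0" using d1 d2 d3 n by (simp add: t_def)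
    have "t * (norm u + norm v) < t * (norm u + norm v + 1)" using t by simp
    also have "\<dots> = min d1 (min d2 d3)" using n by (simp add: t_def)
    finally have l: "dist y x < d1" "dist y x < d2" "y \<in> S"
      if "dist y x \<le> t * (norm u + norm v)" for y
      using that d3(2)[of y] by auto
    have df: "f differentiable (at y)" "(\<lambda>y. frechet_derivative f (at y) w) differentiable (at y)"
      if "y \<in> S" for y w using f that by auto
    obtain y where y: "dist y x \<le> t * (norm u + norm v)"
      "f (x + t *\<^sub>R u + t *\<^sub>R v) - f (x + t *\<^sub>R u) - f (x + t *\<^sub>R v) + f x = t * t * ?A y"
      using second_difference[OF t df(1)[OF l(3)] df(2)[OF l(3)]] by blast
    have sw: "dist y x \<le> t * (norm u + norm v)" if "dist y x \<le> t * (norm v + norm u)" for y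
      using that by (simp add: add.commute)
    obtain z where z: "dist z x \<le> t * (norm v + norm u)"
      "f (x + t *\<^sub>R v + t *\<^sub>R u) - f (x + t *\<^sub>R v) - f (x + t *\<^sub>R u) + f x = t * t * ?B z"
      using second_difference[OF t df(1)[OF l(3)[OF sw]] df(2)[OF l(3)[OF sw]]] by blast
    have "t * t * ?A y = t * t * ?B z"
      using y(2) z(2) by (simp add: algebra_simps)
    then have "?A y = ?B z" using t by simp
    then show ?thesis
      using d1(2)[OF l(1)[OF y(1)]] d2(2)[OF l(2)[OF sw[OF z(1)]]] by linarith
  qed
  then have "\<not> 0 < \<bar>?A x - ?B x\<bar>" by (meson less_irrefl)
  then show ?thesis by simp
qed

lemma frechet_derivative_inner:
  assumes "f differentiable (at x)"
  shows "frechet_derivative (\<lambda>y. f y \<bullet> b) (at x) u = frechet_derivative f (at x) u \<bullet> b"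
  by (simp add: frechet_derivative_at[OF has_derivative_inner_left[OF frechet_derivative_works'[OF assms]],
        symmetric])

lemma Ck_on_inner:
  fixes f :: "'a::real_normed_vector \<Rightarrow> 'b::real_inner"
  assumes "open S" "Ck_on k f S"
  shows "Ck_on k (\<lambda>x. f x \<bullet> b) S"
  using assms(2)
proof (induction k arbitrary: f)
  case 0
  then show ?case by (simp add: continuous_on_inner continuous_on_const)
next
  case (Suc k)
  have "Ck_on k (\<lambda>x. frechet_derivative (\<lambda>x. f x \<bullet> b) (at x) v) S" for v
    by (rule Ck_on_cong[OF assms(1), of "\<lambda>x. frechet_derivative f (at x) v \<bullet> b"])
      (use Suc in \<open>auto simp: frechet_derivative_inner\<close>)
  then show ?case using Suc.prems by (auto intro: differentiable_inner)
qed

lemma second_derivative_commute: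
  fixes f :: "'a::real_normed_vector \<Rightarrow> 'b::euclidean_space"
  assumes S: "open S" "x \<in> S" and f: "Ck_on (Suc (Suc 0)) f S"
  shows "frechet_derivative (\<lambda>y. frechet_derivative f (at y) u) (at x) v =
    frechet_derivative (\<lambda>y. frechet_derivative f (at y) v) (at x) u"
proof (rule euclidean_eqI)
  fix b :: 'b
  have "frechet_derivative (\<lambda>y. frechet_derivative (\<lambda>y. f y \<bullet> b) (at y) u) (at x) v =
      frechet_derivative (\<lambda>y. frechet_derivative f (at y) u) (at x) v \<bullet> b" for u v
  proof -
    have "frechet_derivative (\<lambda>y. frechet_derivative (\<lambda>y. f y \<bullet> b) (at y) u) (at x) =
      frechet_derivative (\<lambda>y. frechet_derivative f (at y) u \<bullet> b) (at x)"
      using f by (intro frechet_derivative_cong_open[OF S]) (auto simp: frechet_derivative_inner)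
    then show ?thesis using f S by (simp add: frechet_derivative_inner)
  qed
  then show "frechet_derivative (\<lambda>y. frechet_derivative f (at y) u) (at x) v \<bullet> b =
    frechet_derivative (\<lambda>y. frechet_derivative f (at y) v) (at x) u \<bullet> b"
    using second_derivative_commute_real[OF S Ck_on_inner[OF S(1) f], of b u v] by simp
qed

text \<open>The product rule for a varying linear map applied to a varying vector. Tensor fields are
  only known to be differentiable for constant arguments, so \<open>p\<close> is expanded in the
  standard basis.\<close>

lemma has_derivative_linear_family:
  fixes L :: "'a::real_normed_vector \<Rightarrow> 'b::euclidean_space \<Rightarrow> 'c::real_normed_vector"
  assumes S: "open S" "x \<in> S" and lin: "\<And>y. y \<in> S \<Longrightarrow> linear (L y)"
    and L: "\<And>b. (\<lambda>y. L y b) differentiable (at x)" and p: "(p has_derivative p') (at x)"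
  shows "((\<lambda>y. L y (p y)) has_derivative
    (\<lambda>u. frechet_derivative (\<lambda>y. L y (p x)) (at x) u + L x (p' u))) (at x)"
proof -
  have ex: "L y v = (\<Sum>b\<in>Basis. (v \<bullet> b) *\<^sub>R L y b)" if "y \<in> S" for y v
    using linear_sum[OF lin[OF that], of "\<lambda>b. (v \<bullet> b) *\<^sub>R b" Basis]
    by (simp add: linear_scale[OF lin[OF that]] euclidean_representation)
  have "((\<lambda>y. \<Sum>b\<in>Basis. (p x \<bullet> b) *\<^sub>R L y b) has_derivative
      (\<lambda>u. \<Sum>b\<in>Basis. (p x \<bullet> b) *\<^sub>R frechet_derivative (\<lambda>y. L y b) (at x) u)) (at x)"
    by (intro has_derivative_sum has_derivative_scaleR_right frechet_derivative_works' L)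
  then have "((\<lambda>y. L y (p x)) has_derivative
      (\<lambda>u. \<Sum>b\<in>Basis. (p x \<bullet> b) *\<^sub>R frechet_derivative (\<lambda>y. L y b) (at x) u)) (at x)"
    by (rule has_derivative_transform_within_open[OF _ S]) (simp add: ex[symmetric])
  from frechet_derivative_at[OF this]
  have D: "frechet_derivative (\<lambda>y. L y (p x)) (at x) u =
      (\<Sum>b\<in>Basis. (p x \<bullet> b) *\<^sub>R frechet_derivative (\<lambda>y. L y b) (at x) u)" for u
    by (simp add: fun_eq_iff)
  have "((\<lambda>y. \<Sum>b\<in>Basis. (p y \<bullet> b) *\<^sub>R L y b) has_derivative
      (\<lambda>u. \<Sum>b\<in>Basis. (p x \<bullet> b) *\<^sub>R frechet_derivative (\<lambda>y. L y b) (at x) u + (p' u \<bullet> b) *\<^sub>R L x b)) (at x)"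
    by (intro has_derivative_sum has_derivative_scaleR has_derivative_inner_left p
        frechet_derivative_works' L)
  then have "((\<lambda>y. L y (p y)) has_derivative
      (\<lambda>u. \<Sum>b\<in>Basis. (p x \<bullet> b) *\<^sub>R frechet_derivative (\<lambda>y. L y b) (at x) u + (p' u \<bullet> b) *\<^sub>R L x b)) (at x)"
    by (rule has_derivative_transform_within_open[OF _ S]) (simp add: ex[symmetric])
  then show ?thesis
    by (simp add: D sum.distrib ex[OF S(2), of "p' _"])
qed

lemma linear_family:
  fixes L :: "'a::real_normed_vector \<Rightarrow> 'b::euclidean_space \<Rightarrow> 'c::real_normed_vector"
  assumes S: "open S" "x \<in> S" and lin: "\<And>y. y \<in> S \<Longrightarrow> linear (L y)"
    and L: "\<And>b. (\<lambda>y. L y b) differentiable (at x)" and p: "p differentiable (at x)"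
  shows "(\<lambda>y. L y (p y)) differentiable (at x)"
    and "frechet_derivative (\<lambda>y. L y (p y)) (at x) u =
      frechet_derivative (\<lambda>y. L y (p x)) (at x) u + L x (frechet_derivative p (at x) u)"
proof -
  have *: "((\<lambda>y. L y (p y)) has_derivative
    (\<lambda>u. frechet_derivative (\<lambda>y. L y (p x)) (at x) u + L x (frechet_derivative p (at x) u))) (at x)"
    by (rule has_derivative_linear_family[where S = S, OF S lin L frechet_derivative_works'[OF p]])
  show "(\<lambda>y. L y (p y)) differentiable (at x)" using * by (auto simp: differentiable_def)
  show "frechet_derivative (\<lambda>y. L y (p y)) (at x) u =
      frechet_derivative (\<lambda>y. L y (p x)) (at x) u + L x (frechet_derivative p (at x) u)"
    by (simp add: frechet_derivative_at[OF *, symmetric])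
qed

lemma frechet_derivative_linear:
  fixes L :: "'b::euclidean_space \<Rightarrow> 'c::real_normed_vector"
  assumes "linear L" "f differentiable (at x)"
  shows "(\<lambda>y. L (f y)) differentiable (at x)"
    and "frechet_derivative (\<lambda>y. L (f y)) (at x) u = L (frechet_derivative f (at x) u)"
proof -
  have *: "((\<lambda>y. L (f y)) has_derivative (\<lambda>u. L (frechet_derivative f (at x) u))) (at x)"
    by (rule bounded_linear.has_derivative[OF linear_conv_bounded_linear[THEN iffD1, OF assms(1)]
          frechet_derivative_works'[OF assms(2)]])
  show "(\<lambda>y. L (f y)) differentiable (at x)" using * by (auto simp: differentiable_def)
  show "frechet_derivative (\<lambda>y. L (f y)) (at x) u = L (frechet_derivative f (at x) u)"
    by (simp add: frechet_derivative_at[OF *, symmetric])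
qed

lemma linear_J: "linear J"
  by (intro linearI) simp_all

section \<open>Bismut torsion-parallel metrics in a chart\<close>

lemma curvature_skew: "curvature \<Gamma> c x u v w = - curvature \<Gamma> c x v u w"
  by (simp add: curvature_def)

locale btp_chart =
  fixes A :: "('m, 'n::finite) chart set" and g :: "('m, 'n) metric"
    and B :: "('m, 'n) christoffel" and c :: "('m, 'n) chart"
  assumes hermitian: "hermitian_metric A g" and bismut: "bismut_connection A g B"
    and parallel: "torsion_parallel A B" and c: "c \<in> A" and open_image: "open (chart_image c)"
begin

abbreviation "S \<equiv> chart_image c"
abbreviation "T \<equiv> torsion B c"

lemma hermitian_form_g:
  assumes "x \<in> S"
  shows "hermitian_form (g c x)"
proof
  show "bilinear (g c x)" and "g c x u v = g c x v u" and "u \<noteq> 0 \<Longrightarrow> g c x u u > 0"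
    and "g c x (J u) (J v) = g c x u v" for u v
    using hermitian c assms unfolding hermitian_metric_def by blast+
qed

lemma Ck_on_g: "Ck_on k (\<lambda>x. g c x u v) S"
  using hermitian c unfolding hermitian_metric_def smooth_on_def by blast

lemma Ck_on_B: "Ck_on k (\<lambda>x. B c x u v) S"
  using bismut c unfolding bismut_connection_def linear_connection_def smooth_on_def by blast

lemma Ck_on_T: "Ck_on k (\<lambda>x. T x u v) S"
  unfolding torsion_def by (intro Ck_on_diff open_image Ck_on_B)

lemma differentiable:
  assumes "x \<in> S"
  shows "(\<lambda>x. g c x u v) differentiable (at x)" "(\<lambda>x. B c x u v) differentiable (at x)"
    "(\<lambda>x. T x u v) differentiable (at x)"
  using Ck_on_g[of "Suc 0" u v] Ck_on_B[of "Suc 0" u v] Ck_on_T[of "Suc 0" u v] assms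
  unfolding Ck_on.simps by blast+

lemma bilinear:
  assumes "x \<in> S"
  shows "bilinear (g c x)" "bilinear (B c x)" "bilinear (T x)"
proof -
  show "bilinear (g c x)" using hermitian c assms unfolding hermitian_metric_def by blast
  show B: "bilinear (B c x)"
    using bismut c assms unfolding bismut_connection_def linear_connection_def by blast
  show "bilinear (T x)"
    unfolding bilinear_def torsion_def
    by (auto intro!: linearI simp: bilinear_ladd[OF B] bilinear_radd[OF B] bilinear_lmul[OF B]
        bilinear_rmul[OF B] scaleR_diff_right)
qed

lemma linear:
  assumes "x \<in> S"
  shows "linear (\<lambda>v. g c x u v)" "linear (\<lambda>v. g c x v u)" "linear (\<lambda>v. B c x u v)"
    "linear (\<lambda>v. T x u v)" "linear (\<lambda>v. T x v u)"
  using bilinear[OF assms] unfolding bilinear_def by blast+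

lemma deriv_g:
  assumes "x \<in> S"
  shows "frechet_derivative (\<lambda>y. g c y v w) (at x) u = g c x (B c x u v) w + g c x v (B c x u w)"
proof -
  have "frechet_derivative (\<lambda>y. g c y v w) (at x) u - g c x (B c x u v) w - g c x v (B c x u w) = 0"
    using bismut c assms unfolding bismut_connection_def metric_parallel_def by blast
  then show ?thesis by simp
qed

lemma B_J: "x \<in> S \<Longrightarrow> B c x u (J v) = J (B c x u v)"
  using bismut c unfolding bismut_connection_def complex_structure_parallel_def by auto

lemma deriv_T:
  assumes "x \<in> S"
  shows "frechet_derivative (\<lambda>y. T y v w) (at x) u =
    T x (B c x u v) w + T x v (B c x u w) - B c x u (T x v w)"
proof -
  have "frechet_derivative (\<lambda>y. T y v w) (at x) u + B c x u (T x v w) -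
        T x (B c x u v) w - T x v (B c x u w) = 0"
    using parallel c assms unfolding torsion_parallel_def by blast
  then show ?thesis by (simp add: algebra_simps)
qed

text \<open>The Ricci identity for the parallel tensor \<open>g\<close>: its second derivatives,
  computed with \<open>deriv_g\<close>, are symmetric in the two directions, and their antisymmetric
  part is the action of the curvature.\<close>

lemma curvature_metric:
  assumes x: "x \<in> S"
  shows "g c x (curvature B c x u v w) z = - g c x (curvature B c x u v z) w"
proof -
  interpret hermitian_form "g c x" using x by (rule hermitian_form_g)
  let ?B = "B c x" and ?D = "\<lambda>u v w. frechet_derivative (\<lambda>y. B c y v w) (at x) u"
  have D2: "frechet_derivative (\<lambda>y. frechet_derivative (\<lambda>y. g c y w z) (at y) v) (at x) u =
    g c x (?B u (?B v w)) z + g c x (?B v w) (?B u z) + g c x (?D u v w) z +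
    (g c x (?B u w) (?B v z) + g c x w (?B u (?B v z)) + g c x w (?D u v z))" for u v
  proof -
    have "frechet_derivative (\<lambda>y. frechet_derivative (\<lambda>y. g c y w z) (at y) v) (at x) =
      frechet_derivative (\<lambda>y. g c y (B c y v w) z + g c y w (B c y v z)) (at x)"
      by (rule frechet_derivative_cong_open[OF open_image x]) (rule deriv_g)
    moreover note linear_family(1)[where L = "\<lambda>y a. g c y a z" and p = "\<lambda>y. B c y v w",
        OF open_image x linear(2) differentiable(1)[OF x] differentiable(2)[OF x]]
      linear_family(2)[where L = "\<lambda>y a. g c y a z" and p = "\<lambda>y. B c y v w" and u = u,
        OF open_image x linear(2) differentiable(1)[OF x] differentiable(2)[OF x]]
    moreover note linear_family(1)[where L = "\<lambda>y a. g c y w a" and p = "\<lambda>y. B c y v z",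
        OF open_image x linear(1) differentiable(1)[OF x] differentiable(2)[OF x]]
      linear_family(2)[where L = "\<lambda>y a. g c y w a" and p = "\<lambda>y. B c y v z" and u = u,
        OF open_image x linear(1) differentiable(1)[OF x] differentiable(2)[OF x]]
    ultimately show ?thesis by (simp add: frechet_derivative_plus deriv_g[OF x])
  qed
  have "frechet_derivative (\<lambda>y. frechet_derivative (\<lambda>y. g c y w z) (at y) v) (at x) u =
    frechet_derivative (\<lambda>y. frechet_derivative (\<lambda>y. g c y w z) (at y) u) (at x) v"
    by (rule second_derivative_commute[OF open_image x Ck_on_g])
  then have "g c x (curvature B c x u v w) z + g c x w (curvature B c x u v z) = 0"
    unfolding D2 curvature_def g_simps by linarith
  then show ?thesis using g_sym[of w "curvature B c x u v z"] by linarith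
qed

text \<open>The Ricci identity again, for the parallel tensor \<open>T\<close>.\<close>

lemma curvature_torsion:
  assumes x: "x \<in> S"
  shows "curvature B c x u v (T x w z) = T x (curvature B c x u v w) z + T x w (curvature B c x u v z)"
proof -
  note simps = bilinear_ladd[OF bilinear(2)[OF x]] bilinear_radd[OF bilinear(2)[OF x]]
    bilinear_lsub[OF bilinear(2)[OF x]] bilinear_rsub[OF bilinear(2)[OF x]]
    bilinear_ladd[OF bilinear(3)[OF x]] bilinear_radd[OF bilinear(3)[OF x]]
    bilinear_lsub[OF bilinear(3)[OF x]] bilinear_rsub[OF bilinear(3)[OF x]]
  let ?B = "B c x" and ?D = "\<lambda>u v w. frechet_derivative (\<lambda>y. B c y v w) (at x) u"
  let ?DT = "\<lambda>u v w. T x (?B u v) w + T x v (?B u w) - ?B u (T x v w)"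
  \<comment> \<open>The derivative of \<open>T y w z\<close> along \<open>v\<close> and then along
    \<open>u\<close>, with first derivatives of \<open>T\<close> eliminated by
    \<open>deriv_T\<close>.\<close>
  define X where "X u v = (?DT u (?B v w) z + T x (?D u v w) z) +
      (?DT u w (?B v z) + T x w (?D u v z)) - (?D u v (T x w z) + ?B v (?DT u w z))" for u v
  have D2: "frechet_derivative (\<lambda>y. frechet_derivative (\<lambda>y. T y w z) (at y) v) (at x) u = X u v" for u v
  proof -
    have "frechet_derivative (\<lambda>y. frechet_derivative (\<lambda>y. T y w z) (at y) v) (at x) =
      frechet_derivative (\<lambda>y. T y (B c y v w) z + T y w (B c y v z) - B c y v (T y w z)) (at x)"
      by (rule frechet_derivative_cong_open[OF open_image x]) (rule deriv_T)
    moreover note linear_family(1)[where L = "\<lambda>y a. T y a z" and p = "\<lambda>y. B c y v w",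
        OF open_image x linear(5) differentiable(3)[OF x] differentiable(2)[OF x]]
      linear_family(2)[where L = "\<lambda>y a. T y a z" and p = "\<lambda>y. B c y v w" and u = u,
        OF open_image x linear(5) differentiable(3)[OF x] differentiable(2)[OF x]]
    moreover note linear_family(1)[where L = "\<lambda>y a. T y w a" and p = "\<lambda>y. B c y v z",
        OF open_image x linear(4) differentiable(3)[OF x] differentiable(2)[OF x]]
      linear_family(2)[where L = "\<lambda>y a. T y w a" and p = "\<lambda>y. B c y v z" and u = u,
        OF open_image x linear(4) differentiable(3)[OF x] differentiable(2)[OF x]]
    moreover note linear_family(1)[where L = "\<lambda>y a. B c y v a" and p = "\<lambda>y. T y w z",
        OF open_image x linear(3) differentiable(2)[OF x] differentiable(3)[OF x]]
      linear_family(2)[where L = "\<lambda>y a. B c y v a" and p = "\<lambda>y. T y w z" and u = u,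
        OF open_image x linear(3) differentiable(2)[OF x] differentiable(3)[OF x]]
    ultimately show ?thesis
      unfolding X_def
      by (simp add: frechet_derivative_plus frechet_derivative_minus differentiable_add deriv_T[OF x])
  qed
  have "frechet_derivative (\<lambda>y. frechet_derivative (\<lambda>y. T y w z) (at y) v) (at x) u =
    frechet_derivative (\<lambda>y. frechet_derivative (\<lambda>y. T y w z) (at y) u) (at x) v"
    by (rule second_derivative_commute[OF open_image x Ck_on_T])
  then have "X u v = X v u" unfolding D2 .
  moreover have "curvature B c x u v (T x w z) - T x (curvature B c x u v w) z -
      T x w (curvature B c x u v z) = X v u - X u v"
    unfolding X_def curvature_def simps by (simp add: algebra_simps)
  ultimately show ?thesis by (simp add: algebra_simps)
qed

text \<open>The first Bianchi identity with torsion. As \<open>T\<close> is \<open>B\<close>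
  antisymmetrised, its derivative is the antisymmetrised derivative of \<open>B\<close>, and
  parallelism makes it algebraic; this is \<open>D\<close>.\<close>

lemma curvature_bianchi:
  assumes x: "x \<in> S"
  shows "curvature B c x u v w + curvature B c x v w u + curvature B c x w u v =
    T x (T x u v) w + T x (T x v w) u + T x (T x w u) v"
proof -
  note simps = bilinear_lsub[OF bilinear(2)[OF x]] bilinear_rsub[OF bilinear(2)[OF x]]
  let ?D = "\<lambda>u v w. frechet_derivative (\<lambda>y. B c y v w) (at x) u"
  have D: "?D u v w - ?D u w v = T x (B c x u v) w + T x v (B c x u w) - B c x u (T x v w)" for u v w
    using deriv_T[OF x, of v w u] frechet_derivative_minus[OF differentiable(2)[OF x] differentiable(2)[OF x]]
    unfolding torsion_def by metis
  have "curvature B c x u v w + curvature B c x v w u + curvature B c x w u v =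
      (?D u v w - ?D u w v) + (?D v w u - ?D v u w) + (?D w u v - ?D w v u) +
      (B c x u (T x v w) + B c x v (T x w u) + B c x w (T x u v))"
    unfolding curvature_def torsion_def simps by (simp add: algebra_simps)
  also have "\<dots> = T x (T x u v) w + T x (T x v w) u + T x (T x w u) v"
    unfolding D unfolding torsion_def simps by (simp add: algebra_simps)
  finally show ?thesis .
qed

lemma parallel_torsion:
  assumes x: "x \<in> S"
  shows "parallel_torsion (g c x) (T x) (curvature B c x)"
proof -
  interpret hermitian_form "g c x" using x by (rule hermitian_form_g)
  show ?thesis
  proof
    show "bilinear (T x)" by (rule bilinear(3)[OF x])
    show "T x u v = - T x v u" for u v by (simp add: torsion_def)
    show "g c x (T x u v) w = - g c x (T x u w) v" for u v w
      using bismut c x unfolding bismut_connection_def skew_torsion_def by blast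
    \<comment> \<open>Both sides expand to the same four \<open>B\<close> terms, since
      \<open>B\<close> commutes with \<open>J\<close> in its second argument.\<close>
    show "T x (J u) (J v) - T x u v = J (T x (J u) v) + J (T x u (J v))" for u v
      by (simp add: torsion_def B_J[OF x])
    show "curvature B c x u v w = - curvature B c x v u w" for u v w by (rule curvature_skew)
    show "g c x (curvature B c x u v w) z = - g c x (curvature B c x u v z) w" for u v w z
      using x by (rule curvature_metric)
    show "curvature B c x u v (J w) = J (curvature B c x u v w)" for u v w
    proof -
      have "frechet_derivative (\<lambda>y. B c y v (J w)) (at x) u = J (frechet_derivative (\<lambda>y. B c y v w) (at x) u)"
        for u v
        using frechet_derivative_cong_open[OF open_image x, of "\<lambda>y. B c y v (J w)" "\<lambda>y. J (B c y v w)"]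
          frechet_derivative_linear(2)[OF linear_J differentiable(2)[OF x]] B_J by simp
      then show ?thesis by (simp add: curvature_def B_J[OF x])
    qed
    show "curvature B c x u v (T x w z) = T x (curvature B c x u v w) z + T x w (curvature B c x u v z)"
      for u v w z using x by (rule curvature_torsion)
    show "curvature B c x u v w + curvature B c x v w u + curvature B c x w u v =
        T x (T x u v) w + T x (T x v w) u + T x (T x w u) v" for u v w
      using x by (rule curvature_bianchi)
  qed
qed

text \<open>The pointwise core of the uniqueness of the Chern connection: the difference
  \<open>d\<close> of the two sides is skew for \<open>g\<close> and commutes with \<open>J\<close>
  in both arguments, hence vanishes. So the right-hand side need not be shown to be a
  connection.\<close>

lemma chern_christoffel:
  assumes chern: "chern_connection A g \<Gamma>" and x: "x \<in> S"
  shows "\<Gamma> c x u v = B c x u v - parallel_torsion.chern_difference (T x) u v"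
proof -
  interpret parallel_torsion "g c x" "T x" "curvature B c x" using x by (rule parallel_torsion)
  define d where "d u v = \<Gamma> c x u v - B c x u v + chern_difference u v" for u v
  have metric: "g c x (d u v) w = - g c x (d u w) v" for u v w
  proof -
    have "frechet_derivative (\<lambda>y. g c y v w) (at x) u - g c x (\<Gamma> c x u v) w - g c x v (\<Gamma> c x u w) = 0"
      using chern c x unfolding chern_connection_def metric_parallel_def by blast
    moreover have "g c x (chern_difference u v) w = - g c x (chern_difference u w) v"
    proof -
      have G: "g c x (T x u v) w + g c x (T x u (J v)) (J w) = 2 * g c x (chern_difference u v) w"
        for v w unfolding chern_difference_def by (simp add: g_J_left)
      have "2 * g c x (chern_difference u v) w + 2 * g c x (chern_difference u w) v = 0"
        unfolding G[symmetric] using T_skew3[of u v w] T_skew3[of u "J v" "J w"] by simp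
      then show ?thesis by simp
    qed
    ultimately show ?thesis
      using deriv_g[OF x, of v w u] g_sym[of v "\<Gamma> c x u w"] g_sym[of v "B c x u w"]
      unfolding d_def g_simps by linarith
  qed
  have J2: "d u (J v) = J (d u v)" for u v
    using chern c x complex_linear_chern_difference[of u]
    unfolding d_def chern_connection_def complex_structure_parallel_def complex_linear_def
    by (simp add: B_J[OF x])
  have J1: "d (J u) v = J (d u v)" for u v
  proof -
    \<comment> \<open>Rewritten like this, \<open>u\<close> occurs only in the second argument of
      \<open>B\<close>, from where \<open>J\<close> can be pulled out.\<close>
    have *: "B c x u v - chern_difference u v = (1 / 2) *\<^sub>R (B c x v u - B c x (J v) (J u))" for u v
      unfolding chern_difference_def torsion_def by (simp add: B_J[OF x] algebra_simps)
    have "\<Gamma> c x (J u) v = J (\<Gamma> c x u v)"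
      using chern c x unfolding chern_connection_def by auto
    moreover have "B c x (J u) v - chern_difference (J u) v = J (B c x u v - chern_difference u v)"
      unfolding * by (simp add: B_J[OF x] bilinear_rneg[OF bilinear(2)[OF x]])
    ultimately show ?thesis unfolding d_def by (simp add: algebra_simps)
  qed
  have "g c x (d u v) w = 0" for u v w
  proof -
    have "g c x (d u v) w = g c x (J (d u v)) (J w)" by (simp add: g_JJ)
    also have "\<dots> = - g c x (d (J u) (J w)) v" using metric[of "J u" v "J w"] J1[of u v] by simp
    also have "d (J u) (J w) = - d u w" by (simp add: J1 J2)
    finally show ?thesis using metric[of u v w] by simp
  qed
  then have "d u v = 0" by (rule eq_0_if_g_0)
  then show ?thesis by (simp add: d_def algebra_simps)
qed

text \<open>\<open>chern_difference\<close> consists of \<open>T\<close> and \<open>J\<close>, so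
  \<open>deriv_T\<close> makes its derivative algebraic. After antisymmetrising, the directions
  \<open>B u v\<close> and \<open>B v u\<close> combine to \<open>T u v\<close>.\<close>

lemma chern_curvature:
  assumes chern: "chern_connection A g \<Gamma>" and x: "x \<in> S"
  shows "curvature \<Gamma> c x u v w =
    parallel_torsion.chern_curvature (T x) (curvature B c x) u v w"
proof -
  interpret parallel_torsion "g c x" "T x" "curvature B c x" using x by (rule parallel_torsion)
  note B_simps = bilinear_ladd[OF bilinear(2)[OF x]] bilinear_radd[OF bilinear(2)[OF x]]
    bilinear_lsub[OF bilinear(2)[OF x]] bilinear_rsub[OF bilinear(2)[OF x]]
    bilinear_lmul[OF bilinear(2)[OF x]] bilinear_rmul[OF bilinear(2)[OF x]]
  have \<Gamma>: "\<Gamma> c y u v = B c y u v - (1 / 2) *\<^sub>R (T y u v - J (T y u (J v)))" if "y \<in> S" for y u v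
    using chern_christoffel[OF chern that] parallel_torsion.chern_difference_def[OF parallel_torsion[OF that]]
    by simp
  let ?D = "\<lambda>u v w. frechet_derivative (\<lambda>y. B c y v w) (at x) u"
  let ?DT = "\<lambda>u v w. T x (B c x u v) w + T x v (B c x u w) - B c x u (T x v w)"
  let ?G = chern_difference
  have D: "frechet_derivative (\<lambda>y. \<Gamma> c y v w) (at x) u =
      ?D u v w - (?G (B c x u v) w + ?G v (B c x u w) - B c x u (?G v w))" for u v w
  proof -
    have d: "(\<lambda>y. T y v w) differentiable (at x)" "(\<lambda>y. J (T y v (J w))) differentiable (at x)"
      using differentiable(3)[OF x] frechet_derivative_linear(1)[OF linear_J] by blast+
    have "frechet_derivative (\<lambda>y. \<Gamma> c y v w) (at x) u =
      frechet_derivative (\<lambda>y. B c y v w - (1 / 2) *\<^sub>R (T y v w - J (T y v (J w)))) (at x) u"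
      using frechet_derivative_cong_open[OF open_image x \<Gamma>] by simp
    also have "\<dots> = ?D u v w - frechet_derivative (\<lambda>y. (1 / 2) *\<^sub>R (T y v w - J (T y v (J w)))) (at x) u"
      using differentiable(2)[OF x] d by (intro frechet_derivative_minus) auto
    also have "frechet_derivative (\<lambda>y. (1 / 2) *\<^sub>R (T y v w - J (T y v (J w)))) (at x) u =
       (1 / 2) *\<^sub>R frechet_derivative (\<lambda>y. T y v w - J (T y v (J w))) (at x) u"
      using d by (intro frechet_derivative_linear(2)) (auto intro: linear_scaleR)
    also have "frechet_derivative (\<lambda>y. T y v w - J (T y v (J w))) (at x) u = ?DT u v w - J (?DT u v (J w))"
      using d frechet_derivative_linear(2)[OF linear_J differentiable(3)[OF x]]
      by (simp add: frechet_derivative_minus deriv_T[OF x] del: J_simps)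
    also have "(1 / 2) *\<^sub>R (?DT u v w - J (?DT u v (J w))) =
        ?G (B c x u v) w + ?G v (B c x u w) - B c x u (?G v w)"
      unfolding chern_difference_def by (simp add: B_simps B_J[OF x] algebra_simps)
    finally show ?thesis .
  qed
  have G_simps: "?G (u - v) w = ?G u w - ?G v w" "?G w (u - v) = ?G w u - ?G w v" for u v w
    unfolding chern_difference_def by (simp_all add: algebra_simps)
  have "?G (T x u v) w = ?G (B c x u v) w - ?G (B c x v u) w"
    by (simp only: G_simps torsion_def[of B c x u v])
  then show ?thesis
    unfolding curvature_def[of \<Gamma>] D chern_christoffel[OF chern x] chern_curvature_def
      curvature_def[of B] B_simps G_simps
    by (simp add: algebra_simps)
qed

lemma herm_eq: "x \<in> S \<Longrightarrow> herm g c x v w = hermitian_form.h (g c x) v w"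
  using hermitian_form.h_def[OF hermitian_form_g] by (simp add: herm_def)

lemma unitary_frame_iff:
  "x \<in> S \<Longrightarrow> unitary_frame g c x e \<longleftrightarrow> hermitian_form.orthonormal (g c x) e UNIV"
  using hermitian_form.orthonormal_def[OF hermitian_form_g] by (simp add: unitary_frame_def herm_eq)

text \<open>The vector is the Lee vector, normalised; a real factor preserves both properties
  required by \<open>chern_curvature_flat\<close>.\<close>

lemma ex_mixed_curvature_0:
  assumes chern: "chern_connection A g \<Gamma>" and x: "x \<in> S"
    and e: "hermitian_form.orthonormal (g c x) e UNIV"
    and lee: "parallel_torsion.lee_vector (g c x) (T x) e \<noteq> 0"
  shows "\<exists>X. herm g c x X X = 1 \<and> mixed_curvature g \<Gamma> \<alpha> \<beta> c x X = 0"
proof -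
  interpret parallel_torsion "g c x" "T x" "curvature B c x" using x by (rule parallel_torsion)
  obtain r where r: "h (r *\<^sub>R lee_vector e) (r *\<^sub>R lee_vector e) = 1"
    using ex_h_normalized[OF lee] .
  define X where "X = r *\<^sub>R lee_vector e"
  have R: "curvature B c x u v X = 0" for u v
    using complex_linear_R[of u v] R_lee_vector[OF e, of u v]
    unfolding X_def complex_linear_def by (simp add: linear_scale)
  have T: "T x X (J X) = 0"
    using T_lee_vector[OF e] unfolding X_def by simp
  define K where "K = curvature \<Gamma> c x X (J X)"
  have K: "K = chern_curvature X (J X)"
    unfolding K_def using chern_curvature[OF chern x] by (simp add: fun_eq_iff)
  \<comment> \<open>The terms of \<open>curv4\<close> at \<open>(X, X)\<close> and
    \<open>(J X, J X)\<close> vanish and the two mixed ones coincide, which gives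
    \<open>2 * \<i> / 4\<close>.\<close>
  have curv4: "curv4 g \<Gamma> c x X X Z W = \<i> / 2 * h (K Z) W" for Z W
  proof -
    have "curvature \<Gamma> c x u u Z = 0" for u
      unfolding curvature_def by simp
    moreover have "curvature \<Gamma> c x (J X) X Z = - K Z"
      unfolding K_def by (rule curvature_skew)
    ultimately show ?thesis
      unfolding curv4_def herm_eq[OF x] by (simp add: K_def)
  qed
  have "hol_sect_curv g \<Gamma> c x X = 0"
    unfolding hol_sect_curv_def curv4 K chern_curvature_flat(1)[OF e R T] by simp
  moreover have "first_ricci g \<Gamma> c x X = 0"
  proof -
    \<comment> \<open>The frame chosen in \<open>first_ricci\<close> may differ from
      \<open>e\<close>, but the trace vanishes in every unitary frame.\<close>
    define e' where "e' = (SOME e. unitary_frame g c x e)"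
    have "unitary_frame g c x e'"
      unfolding e'_def using e unitary_frame_iff[OF x] by (metis someI_ex)
    then have e': "orthonormal e' UNIV" using unitary_frame_iff[OF x] by blast
    show ?thesis
      using chern_curvature_flat(2)[OF e' R T]
      unfolding first_ricci_def e'_def[symmetric] Let_def curv4 K
      by (simp only: sum_distrib_left[symmetric] mult_zero_right)
  qed
  ultimately have "mixed_curvature g \<Gamma> \<alpha> \<beta> c x X = 0" by (simp add: mixed_curvature_def)
  moreover have "herm g c x X X = 1" using r by (simp add: herm_eq[OF x] X_def)
  ultimately show ?thesis by blast
qed

text \<open>\<open>\<psi> u v w\<close> is the derivative along \<open>u\<close> of the Kaehler form
  at \<open>v\<close> and \<open>w\<close>. The product rule differentiates the \<open>j\<close>-th
  factor; the slots shift by one because slot 0 receives the direction of differentiation.\<close>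

lemma ext_deriv_kaehler_power:
  assumes x: "x \<in> S"
  defines "\<psi> \<equiv> \<lambda>u v w. g c x (B c x u (J v)) w + g c x (J v) (B c x u w)"
  shows "ext_deriv (2 * M) (\<lambda>y. wedge_power 2 (kaehler_form g c y) M) x v =
    (\<Sum>j<M. alternation (2 * M + 1) (\<lambda>w. \<psi> (w 0) (w (2 * j + 1)) (w (2 * j + 2)) *
      (\<Prod>i\<in>{..<M} - {j}. g c x (J (w (2 * i + 1))) (w (2 * i + 2)))) v) / 2 ^ M"
proof -
  define F where "F u w = (\<Sum>j<M. \<psi> u (w (2 * j)) (w (2 * j + 1)) *
      (\<Prod>i\<in>{..<M} - {j}. g c x (J (w (2 * i))) (w (2 * i + 1))))" for u and w :: "nat \<Rightarrow> complex^'n"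
  have wp: "wedge_power 2 (kaehler_form g c y) M w =
      (1 / 2 ^ M) * alternation (2 * M) (\<lambda>w. \<Prod>i<M. g c y (J (w (2 * i))) (w (2 * i + 1))) w" for y w
    using wedge_power_2[of "\<lambda>u v. g c y (J u) v" M w] unfolding kaehler_form_def by simp
  have "((\<lambda>y. g c y (J a) b) has_derivative (\<lambda>u. \<psi> u a b)) (at x)" for a b
    using frechet_derivative_works'[OF differentiable(1)[OF x, of "J a" b]]
    by (simp add: deriv_g[OF x] \<psi>_def)
  then have "((\<lambda>y. wedge_power 2 (kaehler_form g c y) M w) has_derivative
      (\<lambda>u. (1 / 2 ^ M) * alternation (2 * M) (F u) w)) (at x)" for w
    unfolding wp alternation_def F_def
    by (intro has_derivative_mult_right has_derivative_sum has_derivative_prod)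
  from frechet_derivative_at[OF this]
  have "frechet_derivative (\<lambda>y. wedge_power 2 (kaehler_form g c y) M w) (at x) u =
      alternation (2 * M) (F u) w / 2 ^ M" for u w by (simp add: fun_eq_iff)
  then have "ext_deriv (2 * M) (\<lambda>y. wedge_power 2 (kaehler_form g c y) M) x v =
    (\<Sum>i\<le>2 * M. (-1) ^ i * alternation (2 * M) (F (v i)) (\<lambda>j. if j < i then v j else v (Suc j))) / 2 ^ M"
    unfolding ext_deriv_def by (simp add: sum_divide_distrib)
  also have "(\<Sum>i\<le>2 * M. (-1) ^ i * alternation (2 * M) (F (v i)) (\<lambda>j. if j < i then v j else v (Suc j))) =
    alternation (Suc (2 * M)) (\<lambda>w. F (w 0) (\<lambda>j. w (Suc j))) v"
    by (rule sum_skip_alternation) (auto simp: F_def intro!: sum.cong prod.cong arg_cong2[of _ _ _ _ "(*)"])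
  finally show ?thesis
    unfolding F_def alternation_sum by simp
qed

text \<open>The cyclic sum of \<open>\<psi>\<close> is the exterior derivative of the Kaehler form,
  and \<open>cyc\<close> is its classical expression by the Bismut torsion. Its trace over the pairs
  \<open>e k\<close>, \<open>J (e k)\<close> is, up to sign, the sum in
  \<open>trace_T_J\<close>.\<close>

lemma ext_deriv_kaehler_power_eq_0:
  assumes x: "x \<in> S" and e: "hermitian_form.orthonormal (g c x) e UNIV"
    and lee: "parallel_torsion.lee_vector (g c x) (T x) e = 0"
  shows "ext_deriv (2 * (CARD('n) - 1)) (\<lambda>y. wedge_power 2 (kaehler_form g c y) (CARD('n) - 1)) x v = 0"
proof -
  interpret parallel_torsion "g c x" "T x" "curvature B c x" using x by (rule parallel_torsion)
  note B_simps = bilinear_ladd[OF bilinear(2)[OF x]] bilinear_radd[OF bilinear(2)[OF x]]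
    bilinear_lmul[OF bilinear(2)[OF x]] bilinear_rmul[OF bilinear(2)[OF x]]
  define \<psi> where "\<psi> u v w = g c x (B c x u (J v)) w + g c x (J v) (B c x u w)" for u v w
  have \<psi>_B: "\<psi> u v w = g c x (J (B c x u v)) w - g c x (J (B c x u w)) v" for u v w
    unfolding \<psi>_def using g_J_left[of "B c x u w" v] g_sym[of "J v" "B c x u w"] by (simp add: B_J[OF x])
  have skew: "\<psi> u v w = - \<psi> u w v" for u v w unfolding \<psi>_B by simp
  have cyc: "\<psi> u v w + \<psi> v w u + \<psi> w u v = - g c x (T x (J u) (J v)) (J w)" for u v w
  proof -
    have "\<psi> u v w + \<psi> v w u + \<psi> w u v =
      g c x (J (T x u v)) w + g c x (J (T x v w)) u + g c x (J (T x w u)) v"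
      unfolding \<psi>_B torsion_def by simp
    also have "\<dots> = - g c x (T x u v) (J w) - g c x (T x v w) (J u) - g c x (T x w u) (J v)"
      by (simp add: g_J_left)
    \<comment> \<open>\<open>T_type\<close>, paired with \<open>J w\<close>, trades the three terms
      containing one \<open>J\<close> for the single term containing three.\<close>
    also have "\<dots> = - g c x (T x (J u) (J v)) (J w)"
    proof -
      have "g c x (T x (J u) (J v)) (J w) - g c x (T x u v) (J w) =
          g c x (T x (J u) v) w + g c x (T x u (J v)) w"
        using arg_cong[OF T_type[of u v], of "\<lambda>a. g c x a (J w)"] by (simp add: g_JJ)
      moreover have "g c x (T x v w) (J u) = g c x (T x (J u) v) w"
        using T_skew3[of v w "J u"] T_skew[of v "J u"] by simp
      moreover have "g c x (T x w u) (J v) = g c x (T x u (J v)) w"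
        using T_skew3[of u w "J v"] T_skew[of w u] by simp
      ultimately show ?thesis by linarith
    qed
    finally show ?thesis .
  qed
  have "(\<Sum>j<CARD('n) - 1. alternation (2 * (CARD('n) - 1) + 1)
      (\<lambda>w. \<psi> (w 0) (w (2 * j + 1)) (w (2 * j + 2)) *
        (\<Prod>i\<in>{..<CARD('n) - 1} - {j}. g c x (J (w (2 * i + 1))) (w (2 * i + 2)))) v) = 0"
  proof (rule alternation_kaehler_eq_0[OF e])
    show "CARD('n) = Suc (CARD('n) - 1)" by simp
    show "linear (\<lambda>u. \<psi> u v w)" "linear (\<lambda>v. \<psi> u v w)" "linear (\<lambda>w. \<psi> u v w)" for u v w
      unfolding \<psi>_B by (auto intro!: linearI simp: B_simps algebra_simps)
    show "\<psi> u v w = - \<psi> u w v" for u v w by (rule skew)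
    fix u
    have "\<psi> u (e k) (J (e k)) + \<psi> (e k) (J (e k)) u + \<psi> (J (e k)) u (e k) =
      - g c x (T x (e k) (J (e k))) (J u)" for k
      unfolding cyc using T_skew3[of "J u" "J (e k)" "e k"] T_skew[of "J u" "e k"]
        T_skew3[of "e k" "J u" "J (e k)"] by simp
    then show "(\<Sum>k\<in>UNIV. \<psi> u (e k) (J (e k)) + \<psi> (e k) (J (e k)) u + \<psi> (J (e k)) u (e k)) = 0"
      using trace_T_J[OF e lee, of "J u"] by (simp add: sum_negf)
  qed
  then show ?thesis unfolding ext_deriv_kaehler_power[OF x] \<psi>_def by simp
qed

end

theorem theorem4:
  fixes M :: "'m topology"
    and A :: "('m, 'n::finite) chart set"
    and g :: "('m, 'n) metric"
    and \<Gamma> :: "('m, 'n) christoffel"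
    and \<alpha> \<beta> c :: real
  assumes "complex_manifold M A" and "compact_space M"
    and "hermitian_metric A g"
    and "\<not> balanced A g"
    and "bismut_torsion_parallel A g"
    and "chern_connection A g \<Gamma>"
    and "(\<alpha>, \<beta>) \<noteq> (0, 0)"
    and "\<And>k x X. k \<in> A \<Longrightarrow> x \<in> chart_image k \<Longrightarrow> herm g k x X X = 1 \<Longrightarrow>
           mixed_curvature g \<Gamma> \<alpha> \<beta> k x X = complex_of_real c"
  shows "c = 0"
proof -
  obtain B where B: "bismut_connection A g B" "torsion_parallel A B"
    using assms(5) unfolding bismut_torsion_parallel_def by blast
  obtain k x v where k: "k \<in> A" and x: "x \<in> chart_image k" and
    nb: "ext_deriv (2 * (CARD('n) - 1))
      (\<lambda>y. wedge_power 2 (kaehler_form g k y) (CARD('n) - 1)) x v \<noteq> 0"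
    using assms(4) unfolding balanced_def by blast
  have "open (chart_image k)"
    using assms(1) k unfolding complex_manifold_def by blast
  then interpret btp_chart A g B k
    by unfold_locales (use assms(3) B k in auto)
  obtain e where e: "hermitian_form.orthonormal (g k x) e UNIV"
    using hermitian_form.ex_orthonormal[OF hermitian_form_g[OF x]] by blast
  have "parallel_torsion.lee_vector (g k x) (torsion B k x) e \<noteq> 0"
    using nb ext_deriv_kaehler_power_eq_0[OF x e] by blast
  then obtain X where "herm g k x X X = 1" "mixed_curvature g \<Gamma> \<alpha> \<beta> k x X = 0"
    using ex_mixed_curvature_0[OF assms(6) x e] by blast
  then show ?thesis using assms(8)[OF k x] by simp
qed

end
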